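(* Let $\mathbf X=(X_1,\dots,X_p)$ be a random vector of real features and $Y\in\{1,\dots,K\}$ a class label, and let $(\mathbf X_i,Y_i)$, $i=1,\dots,n$, be i.i.d. copies of $(\mathbf X,Y)$. For $1\le j,l\le p$ define the Kendall Interaction Filter (KIF) score $$w_{j,l}=\sum_{k=1}^K\pi_k\,|\tau_k(X_j,X_l)-\tau(X_j,X_l)|$$ and its empirical version $$\hat w_{j,l}=\sum_{k=1}^K\hat\pi_k\,|\hat\tau_k(X_j,X_l)-\hat\tau(X_j,X_l)|,$$ with all quantities as defined in the context. Let $\mathbf S\subseteq\{1,\dots,p\}^2$ be the set of relevant couples, $|\mathbf S|=s$, and for constants $c>0$, $r\ge0$ let $\hat{\mathbf S}=\{(j,l):\hat w_{j,l}>cn^{-r}\}$. Assume: (C1) there exist positive constants $c_1,c_2$ with $c_1/K\le\min_k\pi_k\le\max_k\pi_k\le c_2/K$; (C2) there exist constants $c>0$ and $0\le r<1/2$ with $\min_{(j,l)\in\mathbf S}w_{j,l}>2cn^{-r}$; (C3) $K=O(n^d)$ for some $0\le d<\tfrac12-r$; (C4) $\log(p)=o(n^{1-2(r+d)})$. Then there exists a positive constant $b$, depending on $c,c_1,c_2$, such that (i) $\mathbb{P}\big(\max_{1\le j,l\le p}|\hat w_{j,l}-w_{j,l}|\le cn^{-r}\big)\ge 1-O\Big(p^2n^d\exp\big(-c^2n^{1-2(r+d)}/(72b^2)\big)\Big)$; (ii) $\mathbb{P}\big(\mathbf S\subseteq\hat{\mathbf S}\big)\ge 1-O\Big(s\,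n^d\exp\big(-c^2n^{1-2(r+d)}/(72b^2)\big)\Big)$.
   Context: Let $(\tilde{\mathbf X},\tilde Y)$ be an independent copy of $(\mathbf X,Y)$. Kendall's $\tau$: $\tau(X_j,X_l)=2\mathbb{P}((X_j-\tilde X_j)(X_l-\tilde X_l)>0)-1$. Conditional Kendall's $\tau$: $\tau_k(X_j,X_l)=2\mathbb{P}((X_j-\tilde X_j)(X_l-\tilde X_l)>0\mid Y=k,\tilde Y=k)-1$. $\pi_k=\mathbb{P}(Y=k)$. Empirical versions: $n_k=\sum_i\mathbf 1\{Y_i=k\}$, $\hat\pi_k=n_k/n$, $\hat\tau(X_j,X_l)=\frac{4}{n(n-1)}\sum_{1\le i<t\le n}\mathbf 1\{(X_{ij}-X_{tj})(X_{il}-X_{tl})>0\}-1$, $\hat\tau_k(X_j,X_l)=\frac{4}{n_k(n_k-1)}\sum_{1\le i<t\le n}\mathbf 1\{(X_{ij}-X_{tj})(X_{il}-X_{tl})>0,Y_i=k,Y_t=k\}-1$. The set $\mathbf S$ of relevant couples is the set of pairs $(j,l)$ such that the conditional distribution $F(Y\mid\mathbf X)$ functionally depends on the rank association of the couple $(X_j,X_l)$; it is assumed sparse ($s$ much smaller than $p$). The asymptotics are as $n\to\infty$, with $p$, $K$ allowed to depend on $n$. *)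

theory Defs
  imports "HOL-Probability.Probability" "HOL-Library.Landau_Symbols"
begin

text \<open>An observation is a pair (x, y): x :: nat => real is the feature vector
  (only coordinates 1..p are used), y :: nat is the class label.
  D is the joint distribution of (X, Y); an independent copy is modelled by the binary product measure.\<close>

type_synonym obs = "(nat \<Rightarrow> real) \<times> nat"

definition concordant :: "nat \<Rightarrow> nat \<Rightarrow> obs \<Rightarrow> obs \<Rightarrow> bool" where
  "concordant j l a b \<longleftrightarrow> (fst a j - fst b j) * (fst a l - fst b l) > 0"

definition class_prob :: "obs measure \<Rightarrow> nat \<Rightarrow> real" where
  "class_prob D k = measure D {z \<in> space D. snd z = k}"

definition kendall_tau :: "obs measure \<Rightarrow> nat \<Rightarrow> nat \<Rightarrow> real" where
  "kendall_tau D j l =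
     2 * measure (D \<Otimes>\<^sub>M D) {(a, b) \<in> space (D \<Otimes>\<^sub>M D). concordant j l a b} - 1"

definition cond_kendall_tau :: "obs measure \<Rightarrow> nat \<Rightarrow> nat \<Rightarrow> nat \<Rightarrow> real" where
  "cond_kendall_tau D k j l =
     2 * (measure (D \<Otimes>\<^sub>M D) {(a, b) \<in> space (D \<Otimes>\<^sub>M D). concordant j l a b \<and> snd a = k \<and> snd b = k}
          / measure (D \<Otimes>\<^sub>M D) {(a, b) \<in> space (D \<Otimes>\<^sub>M D). snd a = k \<and> snd b = k}) - 1"

definition KIF_score :: "obs measure \<Rightarrow> nat \<Rightarrow> nat \<Rightarrow> nat \<Rightarrow> real" where
  "KIF_score D K j l =
     (\<Sum>k = 1..K. class_prob D k * \<bar>cond_kendall_tau D k j l - kendall_tau D j l\<bar>)"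

text \<open>Empirical versions; a sample of size n is omega :: nat => obs, observations omega 1 .. omega n.\<close>

definition class_count :: "nat \<Rightarrow> (nat \<Rightarrow> obs) \<Rightarrow> nat \<Rightarrow> nat" where
  "class_count n \<omega> k = card {i \<in> {1..n}. snd (\<omega> i) = k}"

definition emp_class_prob :: "nat \<Rightarrow> (nat \<Rightarrow> obs) \<Rightarrow> nat \<Rightarrow> real" where
  "emp_class_prob n \<omega> k = real (class_count n \<omega> k) / real n"

definition emp_kendall_tau :: "nat \<Rightarrow> (nat \<Rightarrow> obs) \<Rightarrow> nat \<Rightarrow> nat \<Rightarrow> real" where
  "emp_kendall_tau n \<omega> j l =
     4 / (real n * (real n - 1)) *
       real (card {(i, t). 1 \<le> i \<and> i < t \<and> t \<le> n \<and> concordant j l (\<omega> i) (\<omega> t)}) - 1"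

definition emp_cond_kendall_tau :: "nat \<Rightarrow> (nat \<Rightarrow> obs) \<Rightarrow> nat \<Rightarrow> nat \<Rightarrow> nat \<Rightarrow> real" where
  "emp_cond_kendall_tau n \<omega> k j l =
     4 / (real (class_count n \<omega> k) * (real (class_count n \<omega> k) - 1)) *
       real (card {(i, t). 1 \<le> i \<and> i < t \<and> t \<le> n \<and> concordant j l (\<omega> i) (\<omega> t)
                          \<and> snd (\<omega> i) = k \<and> snd (\<omega> t) = k}) - 1"

definition emp_KIF_score :: "nat \<Rightarrow> (nat \<Rightarrow> obs) \<Rightarrow> nat \<Rightarrow> nat \<Rightarrow> nat \<Rightarrow> real" where
  "emp_KIF_score n \<omega> K j l =
     (\<Sum>k = 1..K. emp_class_prob n \<omega> k *
        \<bar>emp_cond_kendall_tau n \<omega> k j l - emp_kendall_tau n \<omega> j l\<bar>)"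

definition sample_law :: "nat \<Rightarrow> obs measure \<Rightarrow> (nat \<Rightarrow> obs) measure" where
  "sample_law n D = PiM {1..n} (\<lambda>_. D)"

end

theory Submission
  imports Defs
begin

text \<open>
  Writing \<open>m\<^sub>k\<close> for the size of class \<open>k\<close> in the sample, \<open>n\<close> times the empirical score is the sum over \<open>k\<close>
  of the distances between \<open>m\<^sub>k\<close> times the tau of class \<open>k\<close> and \<open>m\<^sub>k\<close> times the overall tau. Replacing one
  observation affects only two classes and changes this sum by at most 14, whatever the number of classes,
  so McDiarmid's inequality concentrates the empirical score around its own mean with a constant that does
  not depend on \<open>K\<close>. This is why a single \<open>b\<close> works, even for \<open>d = 0\<close>, where a union bound over classes
  would lose a factor depending on the bound for \<open>K\<close> inside the exponential.

  The bias is controlled by second moments of the centred U-statistics of the classes: the mean absolute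
  error of the score is at most \<open>30 K / sqrt n\<close>, which is of smaller order than \<open>n powr (-r)\<close> because
  \<open>d < 1/2 - r\<close>.
\<close>

section \<open>McDiarmid's inequality\<close>

text \<open>The obstacle is the random class size \<open>m\<close> in the denominator of a class
  tau: in a rare class one observation can move the tau by an amount of order one. Multiplied by
  \<open>m\<close>, the same tau moves by a bounded amount, whatever the class.

  Two tools are needed because they answer different demands. A union bound over couples requires
  exponential tails, which bounded differences supply, but only around the mean of the empirical
  score. Because of the absolute values this mean is not the score itself, even for unbiased taus.
  The gap is a single number per couple, so a polynomial bound through second moments is good enough
  for it.

  That bound is summed over the classes, so per class it must be O(sqrt n) uniformly in the class
  probability \<open>q\<close>. It is: the centred pair sum of a class has second moment of order
  n^3 q^2, and it is divided, up to fluctuations of \<open>m\<close>, by the mean class size n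
  q.\<close>

lemma (in product_prob_space) bounded_differences_mgf_le:
  fixes f :: "('i \<Rightarrow> 'a) \<Rightarrow> real" and \<delta> :: "'i \<Rightarrow> real"
  assumes "finite J" and "l > 0"
    and "f \<in> borel_measurable (PiM J M)"
    and "\<And>x. x \<in> space (PiM J M) \<Longrightarrow> \<bar>f x\<bar> \<le> B"
    and "\<And>x i y. x \<in> space (PiM J M) \<Longrightarrow> i \<in> J \<Longrightarrow> y \<in> space (M i) \<Longrightarrow> \<bar>f x - f (x(i := y))\<bar> \<le> \<delta> i"
  shows "(\<integral>\<^sup>+x. exp (l * (f x - (\<integral>x. f x \<partial>PiM J M))) \<partial>PiM J M)
           \<le> ennreal (exp (l\<^sup>2 * (\<Sum>i\<in>J. (\<delta> i)\<^sup>2) / 8))"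
  using \<open>finite J\<close> assms(3-5)
proof (induction J arbitrary: f rule: finite_induct)
  case empty
  have "(\<integral>x. f x \<partial>PiM {} M) = f (\<lambda>_. undefined)"
    by (simp add: PiM_empty lebesgue_integral_count_space_finite)
  then show ?case
    by (simp add: PiM_empty nn_integral_count_space_finite)
next
  case (insert i J)
  note [measurable] = insert.prems(1)
  interpret J: finite_product_prob_space M J
    by unfold_locales (fact insert.hyps)
  interpret iJ: finite_product_prob_space M "insert i J"
    by unfold_locales (use insert.hyps in simp)
  \<comment> \<open>Averaging out the last coordinate splits \<open>f\<close> minus its mean into
    \<open>f - g\<close>, to which Hoeffding's lemma applies with the other coordinates frozen, and
    \<open>g\<close> minus its mean, to which the induction hypothesis applies. This is the
    martingale argument without conditional expectations.\<close>
  define g where "g x = (\<integral>y. f (x(i := y)) \<partial>M i)" for x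
  have upd: "x(i := y) \<in> space (PiM (insert i J) M)"
    if "x \<in> space (PiM J M)" "y \<in> space (M i)" for x y
    using that by (auto simp: space_PiM PiE_def extensional_def Pi_def)
  have upd_J: "x(j := z) \<in> space (PiM J M)"
    if "x \<in> space (PiM J M)" "j \<in> J" "z \<in> space (M j)" for x j z
    using that by (auto simp: space_PiM PiE_def extensional_def Pi_def)
  have bound: "\<bar>f (x(i := y))\<bar> \<le> B" if "x \<in> space (PiM J M)" "y \<in> space (M i)" for x y
    using insert.prems(2) upd that by blast
  have [measurable]: "(\<lambda>y. f (x(i := y))) \<in> borel_measurable (M i)" if "x \<in> space (PiM J M)" for x
  proof -
    have "(\<lambda>y. x(i := y)) \<in> measurable (M i) (PiM (insert i J) M)"
      using that by (intro measurable_fun_upd[where J=J]) auto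
    then show ?thesis
      by (rule measurable_compose) fact
  qed
  have int_section: "integrable (M i) (\<lambda>y. f (x(i := y)))" if "x \<in> space (PiM J M)" for x
    using that bound by (intro M.integrable_const_bound[where B=B] AE_I2) auto
  have int_f: "integrable (PiM (insert i J) M) f"
    using insert.prems(2) by (intro iJ.integrable_const_bound[where B=B] AE_I2) auto
  have pair_meas [measurable]: "(\<lambda>(x, y). f (x(i := y))) \<in> borel_measurable (PiM J M \<Otimes>\<^sub>M M i)"
  proof -
    have "(\<lambda>(x, y). x(i := y)) \<in> measurable (PiM J M \<Otimes>\<^sub>M M i) (PiM (insert i J) M)"
      by (rule measurable_add_dim)
    then have "(\<lambda>p. f ((\<lambda>(x, y). x(i := y)) p)) \<in> borel_measurable (PiM J M \<Otimes>\<^sub>M M i)"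
      by (rule measurable_compose) fact
    then show ?thesis
      by (simp add: case_prod_unfold)
  qed
  have g_meas [measurable]: "g \<in> borel_measurable (PiM J M)"
    unfolding g_def by (rule M.borel_measurable_lebesgue_integral) (fact pair_meas)
  have g_bound: "\<bar>g x\<bar> \<le> B" if x: "x \<in> space (PiM J M)" for x
  proof -
    have "\<bar>g x\<bar> \<le> (\<integral>y. \<bar>f (x(i := y))\<bar> \<partial>M i)"
      unfolding g_def by (rule integral_abs_bound)
    also have "\<dots> \<le> B"
      using x bound by (intro M.integral_le_const integrable_abs int_section AE_I2)
    finally show ?thesis .
  qed
  have g_diff: "\<bar>g x - g (x(j := z))\<bar> \<le> \<delta> j"
    if x: "x \<in> space (PiM J M)" and j: "j \<in> J" and z: "z \<in> space (M j)" for x j z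
  proof -
    have "j \<noteq> i" using j insert.hyps by auto
    have "g x - g (x(j := z)) = (\<integral>y. f (x(i := y)) - f (x(j := z, i := y)) \<partial>M i)"
      unfolding g_def
      by (rule Bochner_Integration.integral_diff[symmetric]) (intro int_section x upd_J[OF x j z])+
    also have "\<bar>\<dots>\<bar> \<le> (\<integral>y. \<bar>f (x(i := y)) - f (x(j := z, i := y))\<bar> \<partial>M i)"
      by (rule integral_abs_bound)
    also have "\<dots> \<le> \<delta> j"
    proof (intro M.integral_le_const integrable_abs Bochner_Integration.integrable_diff
        int_section x upd_J[OF x j z] AE_I2)
      fix y assume y: "y \<in> space (M i)"
      have "\<bar>f (x(i := y)) - f ((x(i := y))(j := z))\<bar> \<le> \<delta> j"
        by (rule insert.prems(3)[OF upd[OF x y] _ z]) (use j in simp)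
      then show "\<bar>f (x(i := y)) - f (x(j := z, i := y))\<bar> \<le> \<delta> j"
        unfolding fun_upd_twist[OF \<open>j \<noteq> i\<close>] .
    qed
    finally show ?thesis .
  qed
  have mean: "(\<integral>x. f x \<partial>PiM (insert i J) M) = (\<integral>x. g x \<partial>PiM J M)"
    unfolding g_def by (rule product_integral_insert) (use insert.hyps int_f in auto)
  let ?m = "\<integral>x. g x \<partial>PiM J M"
  have mgf_section: "(\<integral>\<^sup>+y. exp (l * (f (x(i := y)) - g x)) \<partial>M i) \<le> ennreal (exp (l\<^sup>2 * (\<delta> i)\<^sup>2 / 8))"
    if x: "x \<in> space (PiM J M)" for x
  proof -
    \<comment> \<open>The oscillation of \<open>f\<close> in coordinate \<open>i\<close> is at most
      \<open>\<delta> i\<close>, so the values lie in an interval of that length starting at the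
      infimum \<open>a\<close>. The interval depends on \<open>x\<close>, but only its length enters
      Hoeffding's lemma.\<close>
    define a where "a = (INF y\<in>space (M i). f (x(i := y)))"
    have bdd: "bdd_below ((\<lambda>y. f (x(i := y))) ` space (M i))"
      using bound[OF x] by (intro bdd_belowI2[of _ "- B"]) (smt (verit))
    have "f (x(i := y)) \<in> {a..a + \<delta> i}" if y: "y \<in> space (M i)" for y
    proof -
      have "a \<le> f (x(i := y))"
        unfolding a_def by (rule cINF_lower[OF bdd y])
      moreover have "f (x(i := y)) - \<delta> i \<le> a"
        unfolding a_def
      proof (rule cINF_greatest)
        fix z assume z: "z \<in> space (M i)"
        have "\<bar>f (x(i := y)) - f ((x(i := y))(i := z))\<bar> \<le> \<delta> i"
          by (rule insert.prems(3)[OF upd[OF x y] _ z]) simp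
        then show "f (x(i := y)) - \<delta> i \<le> f (x(i := z))"
          by simp
      qed (use y in auto)
      ultimately show ?thesis by simp
    qed
    then interpret S: interval_bounded_random_variable "M i" "\<lambda>y. f (x(i := y))" a "a + \<delta> i"
      by unfold_locales (use x in auto)
    show ?thesis
      using S.Hoeffdings_lemma_nn_integral[OF \<open>l > 0\<close>] by (simp add: g_def)
  qed
  have "(\<integral>\<^sup>+x. exp (l * (f x - ?m)) \<partial>PiM (insert i J) M)
      = (\<integral>\<^sup>+x. \<integral>\<^sup>+y. exp (l * (f (x(i := y)) - ?m)) \<partial>M i \<partial>PiM J M)"
    by (rule product_nn_integral_insert) (use insert.hyps in auto)
  also have "\<dots> \<le> (\<integral>\<^sup>+x. ennreal (exp (l\<^sup>2 * (\<delta> i)\<^sup>2 / 8)) * exp (l * (g x - ?m)) \<partial>PiM J M)"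
  proof (rule nn_integral_mono)
    fix x assume x: "x \<in> space (PiM J M)"
    have "(\<integral>\<^sup>+y. exp (l * (f (x(i := y)) - ?m)) \<partial>M i)
        = (\<integral>\<^sup>+y. ennreal (exp (l * (f (x(i := y)) - g x))) * exp (l * (g x - ?m)) \<partial>M i)"
      by (intro nn_integral_cong) (simp add: ennreal_mult[symmetric] exp_add[symmetric] algebra_simps)
    also have "\<dots> = (\<integral>\<^sup>+y. exp (l * (f (x(i := y)) - g x)) \<partial>M i) * exp (l * (g x - ?m))"
      using x by (intro nn_integral_multc) auto
    also have "\<dots> \<le> ennreal (exp (l\<^sup>2 * (\<delta> i)\<^sup>2 / 8)) * exp (l * (g x - ?m))"
      by (intro mult_right_mono mgf_section x) simp
    finally show "(\<integral>\<^sup>+y. exp (l * (f (x(i := y)) - ?m)) \<partial>M i)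
        \<le> ennreal (exp (l\<^sup>2 * (\<delta> i)\<^sup>2 / 8)) * exp (l * (g x - ?m))" .
  qed
  also have "\<dots> = ennreal (exp (l\<^sup>2 * (\<delta> i)\<^sup>2 / 8)) * (\<integral>\<^sup>+x. exp (l * (g x - ?m)) \<partial>PiM J M)"
    by (rule nn_integral_cmult) measurable
  also have "\<dots> \<le> ennreal (exp (l\<^sup>2 * (\<delta> i)\<^sup>2 / 8)) * ennreal (exp (l\<^sup>2 * (\<Sum>i\<in>J. (\<delta> i)\<^sup>2) / 8))"
    by (intro mult_left_mono insert.IH g_meas g_bound g_diff) auto
  also have "\<dots> = ennreal (exp (l\<^sup>2 * (\<Sum>i\<in>insert i J. (\<delta> i)\<^sup>2) / 8))"
    using insert.hyps by (simp add: ennreal_mult[symmetric] exp_add[symmetric] algebra_simps add_divide_distrib)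
  finally show ?case
    by (simp add: mean)
qed

lemma (in product_prob_space) McDiarmid_ineq_ge:
  fixes f :: "('i \<Rightarrow> 'a) \<Rightarrow> real" and \<delta> :: "'i \<Rightarrow> real"
  assumes "finite J" and t: "t > 0" and pos: "(\<Sum>i\<in>J. (\<delta> i)\<^sup>2) > 0"
    and [measurable]: "f \<in> borel_measurable (PiM J M)"
    and bound: "\<And>x. x \<in> space (PiM J M) \<Longrightarrow> \<bar>f x\<bar> \<le> B"
    and diff: "\<And>x i y. x \<in> space (PiM J M) \<Longrightarrow> i \<in> J \<Longrightarrow> y \<in> space (M i) \<Longrightarrow> \<bar>f x - f (x(i := y))\<bar> \<le> \<delta> i"
  shows "measure (PiM J M) {x \<in> space (PiM J M). f x - (\<integral>x. f x \<partial>PiM J M) \<ge> t}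
           \<le> exp (- 2 * t\<^sup>2 / (\<Sum>i\<in>J. (\<delta> i)\<^sup>2))"
proof -
  interpret J: finite_product_prob_space M J
    by unfold_locales fact
  let ?m = "\<integral>x. f x \<partial>PiM J M"
  define s where "s = (\<Sum>i\<in>J. (\<delta> i)\<^sup>2)"
  \<comment> \<open>The minimiser of \<open>l^2 * s / 8 - l * t\<close>, the exponent that
    Chernoff's bound produces.\<close>
  define l where "l = 4 * t / s"
  have "s > 0" "l > 0"
    using t pos by (auto simp: l_def s_def)
  have "ennreal (measure (PiM J M) {x \<in> space (PiM J M). f x - ?m \<ge> t})
      = emeasure (PiM J M) {x \<in> space (PiM J M). f x - ?m \<ge> t}"
    by (simp add: J.emeasure_eq_measure)
  also have "\<dots> \<le> ennreal (exp (- l * t)) * (\<integral>\<^sup>+x\<in>space (PiM J M). exp (l * (f x - ?m)) \<partial>PiM J M)"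
    by (intro Chernoff_ineq_nn_integral_ge \<open>l > 0\<close>) auto
  also have "(\<integral>\<^sup>+x\<in>space (PiM J M). exp (l * (f x - ?m)) \<partial>PiM J M) = (\<integral>\<^sup>+x. exp (l * (f x - ?m)) \<partial>PiM J M)"
    by (intro nn_integral_cong) auto
  also have "ennreal (exp (- l * t)) * \<dots> \<le> ennreal (exp (- l * t)) * ennreal (exp (l\<^sup>2 * s / 8))"
    unfolding s_def
    by (intro mult_left_mono bounded_differences_mgf_le[OF assms(1) \<open>l > 0\<close>, where B=B] bound diff) auto
  also have "\<dots> = ennreal (exp (l\<^sup>2 * s / 8 - l * t))"
    by (simp add: ennreal_mult[symmetric] exp_add[symmetric])
  also have "l\<^sup>2 * s / 8 - l * t = - 2 * t\<^sup>2 / s"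
    using \<open>s > 0\<close> by (simp add: l_def field_simps power2_eq_square)
  finally show ?thesis
    by (simp add: s_def)
qed

lemma (in product_prob_space) McDiarmid_ineq_abs_ge:
  fixes f :: "('i \<Rightarrow> 'a) \<Rightarrow> real" and \<delta> :: "'i \<Rightarrow> real"
  assumes fin: "finite J" and t: "t > 0" and pos: "(\<Sum>i\<in>J. (\<delta> i)\<^sup>2) > 0"
    and [measurable]: "f \<in> borel_measurable (PiM J M)"
    and bound: "\<And>x. x \<in> space (PiM J M) \<Longrightarrow> \<bar>f x\<bar> \<le> B"
    and diff: "\<And>x i y. x \<in> space (PiM J M) \<Longrightarrow> i \<in> J \<Longrightarrow> y \<in> space (M i) \<Longrightarrow> \<bar>f x - f (x(i := y))\<bar> \<le> \<delta> i"
  shows "measure (PiM J M) {x \<in> space (PiM J M). \<bar>f x - (\<integral>x. f x \<partial>PiM J M)\<bar> \<ge> t}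
           \<le> 2 * exp (- 2 * t\<^sup>2 / (\<Sum>i\<in>J. (\<delta> i)\<^sup>2))"
proof -
  interpret J: finite_product_prob_space M J
    by unfold_locales fact
  let ?m = "\<integral>x. f x \<partial>PiM J M"
  let ?e = "exp (- 2 * t\<^sup>2 / (\<Sum>i\<in>J. (\<delta> i)\<^sup>2))"
  have up: "J.prob {x \<in> space (PiM J M). f x - ?m \<ge> t} \<le> ?e"
    by (rule McDiarmid_ineq_ge[OF fin t pos, where B=B]) (auto simp: bound diff)
  have "J.prob {x \<in> space (PiM J M). - f x - (\<integral>x. - f x \<partial>PiM J M) \<ge> t} \<le> ?e"
    by (rule McDiarmid_ineq_ge[OF fin t pos, where B=B]) (auto simp: bound diff abs_minus_commute)
  then have down: "J.prob {x \<in> space (PiM J M). - f x + ?m \<ge> t} \<le> ?e"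
    by simp
  have "{x \<in> space (PiM J M). \<bar>f x - ?m\<bar> \<ge> t}
      = {x \<in> space (PiM J M). f x - ?m \<ge> t} \<union> {x \<in> space (PiM J M). - f x + ?m \<ge> t}"
    by auto
  then have "J.prob {x \<in> space (PiM J M). \<bar>f x - ?m\<bar> \<ge> t}
      \<le> J.prob {x \<in> space (PiM J M). f x - ?m \<ge> t} + J.prob {x \<in> space (PiM J M). - f x + ?m \<ge> t}"
    by (simp add: measure_Un_le)
  with up down show ?thesis
    by linarith
qed

section \<open>Bounded differences of the empirical score\<close>

text \<open>The relation is on indices and not on observations, so that replacing observation
  \<open>i\<close> leaves the relation intact on any set that omits \<open>i\<close>.\<close>

definition pair_count :: "nat set \<Rightarrow> (nat \<Rightarrow> nat \<Rightarrow> bool) \<Rightarrow> nat" where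
  "pair_count C R = card {(i, t). i \<in> C \<and> t \<in> C \<and> i < t \<and> R i t}"

text \<open>For \<open>C\<close> of size \<open>m\<close> this is \<open>m\<close> times the empirical tau of \<open>C\<close>. For \<open>m = 1\<close> the division by zero
  gives the value \<open>-1\<close>, in agreement with \<open>emp_cond_kendall_tau\<close>.\<close>

definition scaled_tau :: "nat set \<Rightarrow> (nat \<Rightarrow> nat \<Rightarrow> bool) \<Rightarrow> real" where
  "scaled_tau C R = 4 * real (pair_count C R) / (real (card C) - 1) - real (card C)"

lemma finite_pairs: "finite C \<Longrightarrow> finite {(i, t). i \<in> C \<and> t \<in> C \<and> i < t \<and> R i (t::nat)}"
  by (rule finite_subset[of _ "C \<times> C"]) auto

lemma pair_count_empty [simp]: "pair_count {} R = 0"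
  by (simp add: pair_count_def)

text \<open>Every unordered pair is counted once, smaller index first. The new pairs are therefore
  \<open>(min i t, max i t)\<close>, one for each \<open>t\<close> related to \<open>i\<close>;
  symmetry of \<open>R\<close> makes the orientation irrelevant.\<close>

lemma pair_count_insert:
  assumes "finite C" "i \<notin> C" "symp R"
  shows "pair_count (insert i C) R = pair_count C R + card {t \<in> C. R i t}"
proof -
  let ?P = "\<lambda>C. {(s, t). s \<in> C \<and> t \<in> C \<and> s < t \<and> R s t}"
  let ?e = "\<lambda>t. (min i t, max i t)"
  have "?P (insert i C) = ?P C \<union> ?e ` {t \<in> C. R i t}"
  proof (intro set_eqI iffI)
    fix p assume p: "p \<in> ?P (insert i C)"
    then obtain s t where [simp]: "p = (s, t)" and st: "s \<in> insert i C" "t \<in> insert i C" "s < t" "R s t"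
      by auto
    consider "s = i" | "t = i" | "s \<in> C" "t \<in> C"
      using st by auto
    then show "p \<in> ?P C \<union> ?e ` {t \<in> C. R i t}"
    proof cases
      case 1
      then have "p = ?e t" "t \<in> C" "R i t"
        using st by auto
      then show ?thesis by blast
    next
      case 2
      then have "p = ?e s" "s \<in> C" "R i s"
        using st sympD[OF \<open>symp R\<close>] by auto
      then show ?thesis by blast
    qed (use st in auto)
  next
    fix p assume "p \<in> ?P C \<union> ?e ` {t \<in> C. R i t}"
    then show "p \<in> ?P (insert i C)"
    proof
      assume "p \<in> ?e ` {t \<in> C. R i t}"
      then obtain t where t: "t \<in> C" "R i t" "p = ?e t"
        by auto
      moreover have "t \<noteq> i" using t \<open>i \<notin> C\<close> by auto
      ultimately show ?thesis
        using sympD[OF \<open>symp R\<close> \<open>R i t\<close>] by (cases "i < t") (auto simp: min_def max_def)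
    qed auto
  qed
  moreover have "?P C \<inter> ?e ` {t \<in> C. R i t} = {}"
    using \<open>i \<notin> C\<close> by (auto simp: min_def max_def split: if_splits)
  moreover have "inj_on ?e {t \<in> C. R i t}"
    by (auto simp: inj_on_def min_def max_def split: if_splits)
  ultimately show ?thesis
    using \<open>finite C\<close> by (simp add: pair_count_def card_Un_disjoint finite_pairs card_image)
qed

lemma card_less_pairs:
  fixes C :: "nat set"
  assumes "finite C"
  shows "2 * real (card {(i, t). i \<in> C \<and> t \<in> C \<and> i < t}) = real (card C) * (real (card C) - 1)"
  using assms
proof (induction C)
  case (insert i C)
  have "pair_count (insert i C) (\<lambda>_ _. True) = pair_count C (\<lambda>_ _. True) + card C"
    using insert.hyps by (subst pair_count_insert) (auto intro: sympI)
  with insert show ?case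
    by (simp add: pair_count_def algebra_simps)
qed simp

lemma pair_count_le:
  assumes "finite C"
  shows "2 * real (pair_count C R) \<le> real (card C) * (real (card C) - 1)"
proof -
  have "pair_count C R \<le> card {(i, t). i \<in> C \<and> t \<in> C \<and> i < t}"
    unfolding pair_count_def using finite_pairs[OF assms, of "\<lambda>_ _. True"]
    by (intro card_mono) auto
  with card_less_pairs[OF assms] show ?thesis
    by linarith
qed

lemma pair_count_cong:
  "(\<And>i t. i \<in> C \<Longrightarrow> t \<in> C \<Longrightarrow> R i t \<longleftrightarrow> R' i t) \<Longrightarrow> pair_count C R = pair_count C R'"
  unfolding pair_count_def by (intro arg_cong[where f=card]) auto

lemma scaled_tau_cong:
  "(\<And>i t. i \<in> C \<Longrightarrow> t \<in> C \<Longrightarrow> R i t \<longleftrightarrow> R' i t) \<Longrightarrow> scaled_tau C R = scaled_tau C R'"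
  unfolding scaled_tau_def using pair_count_cong[of C R R'] by simp

lemma abs_scaled_tau_le:
  assumes "finite C"
  shows "\<bar>scaled_tau C R\<bar> \<le> real (card C)"
proof (cases "card C \<le> 1")
  case True
  then have "card C = 0 \<or> card C = 1" by linarith
  moreover have "pair_count C R = 0" if "card C = 0 \<or> card C = 1"
    using pair_count_le[OF assms, of R] that by auto
  ultimately show ?thesis
    by (auto simp: scaled_tau_def)
next
  case False
  then have "4 * real (pair_count C R) / (real (card C) - 1) \<le> 2 * real (card C)"
    using pair_count_le[OF assms, of R] by (simp add: divide_le_eq algebra_simps)
  moreover have "0 \<le> 4 * real (pair_count C R) / (real (card C) - 1)"
    using False by simp
  ultimately show ?thesis
    by (simp add: scaled_tau_def)
qed

text \<open>For \<open>m \<ge> 2\<close> the increment is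
  \<open>4 * e / m - 4 * N / (m * (m - 1)) - 1\<close>, with the first term in [0, 4] and the second
  in [0, 2], hence between -3 and 3. The sizes 0 and 1 are treated apart, since there the default
  value of division by zero decides.\<close>

lemma scaled_tau_insert_diff:
  assumes "finite C" "i \<notin> C" "symp R"
  shows "\<bar>scaled_tau (insert i C) R - scaled_tau C R\<bar> \<le> 3"
proof -
  define m where "m = card C"
  define e where "e = real (card {t \<in> C. R i t})"
  define N where "N = real (pair_count C R)"
  have ins: "scaled_tau (insert i C) R = 4 * (N + e) / real m - (real m + 1)"
    using assms by (simp add: scaled_tau_def pair_count_insert m_def e_def N_def)
  have C: "scaled_tau C R = 4 * N / (real m - 1) - real m"
    by (simp add: scaled_tau_def m_def N_def)
  have e: "0 \<le> e" "e \<le> real m"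
    unfolding e_def m_def by (auto intro!: card_mono assms)
  have N: "0 \<le> N" "2 * N \<le> real m * (real m - 1)"
    using pair_count_le[OF assms(1), of R] by (auto simp: N_def m_def)
  consider "m = 0" | "m = 1" | "m \<ge> 2"
    by linarith
  then show ?thesis
  proof cases
    case 1
    with N show ?thesis by (simp add: ins C)
  next
    case 2
    with N e show ?thesis by (simp add: ins C)
  next
    case 3
    then have "real m \<ge> 2" by simp
    then have "scaled_tau (insert i C) R - scaled_tau C R = 4 * e / m - 4 * N / (m * (real m - 1)) - 1"
      by (simp add: ins C field_simps)
    moreover have "0 \<le> 4 * e / m" "4 * e / m \<le> 4"
      using e \<open>real m \<ge> 2\<close> by (simp_all add: divide_le_eq)
    moreover have "0 \<le> 4 * N / (m * (real m - 1))" "4 * N / (m * (real m - 1)) \<le> 2"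
      using N \<open>real m \<ge> 2\<close> by (simp_all add: divide_le_eq)
    ultimately show ?thesis by linarith
  qed
qed

text \<open>Samples that differ at \<open>i\<close> agree once \<open>i\<close> is removed, so they
  are compared through this common part. The factor \<open>of_bool\<close> records which classes pay
  for the removal.\<close>

lemma scaled_tau_remove_diff:
  assumes "finite C" "symp R"
  shows "\<bar>scaled_tau C R - scaled_tau (C - {i}) R\<bar> \<le> 3 * of_bool (i \<in> C)"
proof (cases "i \<in> C")
  case True
  then have "C = insert i (C - {i})" by auto
  with True show ?thesis
    using scaled_tau_insert_diff[of "C - {i}" i R] assms by simp
qed simp

section \<open>The empirical score in terms of scaled taus\<close>

definition class_indices :: "nat \<Rightarrow> (nat \<Rightarrow> obs) \<Rightarrow> nat \<Rightarrow> nat set" where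
  "class_indices n \<omega> k = {i \<in> {1..n}. snd (\<omega> i) = k}"

abbreviation sample_concordant :: "nat \<Rightarrow> nat \<Rightarrow> (nat \<Rightarrow> obs) \<Rightarrow> nat \<Rightarrow> nat \<Rightarrow> bool" where
  "sample_concordant j l \<omega> \<equiv> (\<lambda>i t. concordant j l (\<omega> i) (\<omega> t))"

lemma concordant_sym: "concordant j l a b \<longleftrightarrow> concordant j l b a"
proof -
  have "(fst a j - fst b j) * (fst a l - fst b l) = (fst b j - fst a j) * (fst b l - fst a l)"
    by (simp add: algebra_simps)
  then show ?thesis
    by (simp add: concordant_def)
qed

lemma symp_sample_concordant: "symp (sample_concordant j l \<omega>)"
  by (rule sympI) (rule concordant_sym[THEN iffD1])

lemma finite_class_indices [simp]: "finite (class_indices n \<omega> k)"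
  by (simp add: class_indices_def)

lemma class_count_eq: "class_count n \<omega> k = card (class_indices n \<omega> k)"
  by (simp add: class_count_def class_indices_def)

text \<open>At \<open>m = 1\<close> both sides are -1, because both quotients are divisions by zero.
  The case \<open>m = 0\<close> is an empty class and is settled separately where this is
  applied.\<close>

lemma scaled_tau_rescale:
  fixes m N :: real
  assumes "m \<noteq> 0"
  shows "m * (4 / (m * (m - 1)) * N - 1) = 4 * N / (m - 1) - m"
  using assms by (cases "m = 1") (simp_all add: field_simps)

lemma scaled_tau_class:
  "real (class_count n \<omega> k) * emp_cond_kendall_tau n \<omega> k j l
     = scaled_tau (class_indices n \<omega> k) (sample_concordant j l \<omega>)"
proof -
  let ?C = "class_indices n \<omega> k"
  have "{(i, t). 1 \<le> i \<and> i < t \<and> t \<le> n \<and> concordant j l (\<omega> i) (\<omega> t) \<and> snd (\<omega> i) = k \<and> snd (\<omega> t) = k}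
      = {(i, t). i \<in> ?C \<and> t \<in> ?C \<and> i < t \<and> concordant j l (\<omega> i) (\<omega> t)}"
    by (auto simp: class_indices_def)
  then have "emp_cond_kendall_tau n \<omega> k j l
      = 4 / (real (card ?C) * (real (card ?C) - 1)) * real (pair_count ?C (sample_concordant j l \<omega>)) - 1"
    by (simp add: emp_cond_kendall_tau_def pair_count_def class_count_eq)
  then show ?thesis
    using scaled_tau_rescale[of "real (card ?C)" "real (pair_count ?C (sample_concordant j l \<omega>))"]
    by (cases "?C = {}") (simp_all add: scaled_tau_def class_count_eq)
qed

lemma scaled_tau_all:
  assumes "n \<ge> 1"
  shows "real n * emp_kendall_tau n \<omega> j l = scaled_tau {1..n} (sample_concordant j l \<omega>)"
proof -
  have "{(i, t). 1 \<le> i \<and> i < t \<and> t \<le> n \<and> concordant j l (\<omega> i) (\<omega> t)}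
      = {(i, t). i \<in> {1..n} \<and> t \<in> {1..n} \<and> i < t \<and> concordant j l (\<omega> i) (\<omega> t)}"
    by auto
  then show ?thesis
    using assms scaled_tau_rescale[of "real n" "real (pair_count {1..n} (sample_concordant j l \<omega>))"]
    by (simp add: emp_kendall_tau_def pair_count_def scaled_tau_def)
qed

lemma abs_emp_kendall_tau_le:
  assumes "n \<ge> 1"
  shows "\<bar>emp_kendall_tau n \<omega> j l\<bar> \<le> 1"
proof -
  have "real n * \<bar>emp_kendall_tau n \<omega> j l\<bar> \<le> real n * 1"
    using abs_scaled_tau_le[of "{1..n}" "sample_concordant j l \<omega>"] scaled_tau_all[OF assms, of \<omega> j l]
    by (simp flip: abs_mult)
  with assms show ?thesis
    by (subst (asm) mult_le_cancel_left_pos) auto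
qed

lemma emp_KIF_score_eq:
  "real n * emp_KIF_score n \<omega> K j l
     = (\<Sum>k=1..K. \<bar>scaled_tau (class_indices n \<omega> k) (sample_concordant j l \<omega>)
          - real (class_count n \<omega> k) * emp_kendall_tau n \<omega> j l\<bar>)"
proof (cases "n = 0")
  case True
  then show ?thesis
    by (simp add: class_indices_def class_count_def scaled_tau_def)
next
  case False
  have "real n * (emp_class_prob n \<omega> k * \<bar>emp_cond_kendall_tau n \<omega> k j l - emp_kendall_tau n \<omega> j l\<bar>)
     = \<bar>scaled_tau (class_indices n \<omega> k) (sample_concordant j l \<omega>)
          - real (class_count n \<omega> k) * emp_kendall_tau n \<omega> j l\<bar>" for k
    using False scaled_tau_class[of n \<omega> k j l, symmetric]
    by (simp add: emp_class_prob_def right_diff_distrib[symmetric] abs_mult)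
  then show ?thesis
    by (simp add: emp_KIF_score_def sum_distrib_left)
qed

text \<open>Only an inequality, since an arbitrary \<open>\<omega>\<close> may carry labels outside
  \<open>{1..K}\<close>. This keeps the bounded differences valid at every point of the sample space
  and not just almost surely.\<close>

lemma sum_class_count_le: "(\<Sum>k=1..K. real (class_count n \<omega> k)) \<le> real n"
proof -
  have "(\<Sum>k=1..K. card (class_indices n \<omega> k)) = card (\<Union>k\<in>{1..K}. class_indices n \<omega> k)"
    by (rule card_UN_disjoint[symmetric]) (auto simp: class_indices_def)
  also have "\<dots> \<le> card {1..n}"
    by (rule card_mono) (auto simp: class_indices_def)
  finally show ?thesis
    by (simp add: class_count_eq flip: of_nat_sum)
qed

lemma sum_of_bool_class_le: "(\<Sum>k=1..K. of_bool (i \<in> class_indices n \<omega> k) :: real) \<le> 1"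
proof -
  have "(\<Sum>k=1..K. of_bool (i \<in> class_indices n \<omega> k) :: real) \<le> (\<Sum>k=1..K. if k = snd (\<omega> i) then 1 else 0)"
    by (intro sum_mono) (auto simp: class_indices_def)
  also have "\<dots> \<le> 1" by simp
  finally show ?thesis .
qed

lemma emp_KIF_score_bounds: "0 \<le> emp_KIF_score n \<omega> K j l" "emp_KIF_score n \<omega> K j l \<le> 2"
proof -
  show "0 \<le> emp_KIF_score n \<omega> K j l"
    unfolding emp_KIF_score_def emp_class_prob_def by (intro sum_nonneg) simp
  show "emp_KIF_score n \<omega> K j l \<le> 2"
  proof (cases "n = 0")
    case True
    then show ?thesis by (simp add: emp_KIF_score_def emp_class_prob_def)
  next
    case False
    have "real n * emp_KIF_score n \<omega> K j l \<le> (\<Sum>k=1..K. 2 * real (class_count n \<omega> k))"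
      unfolding emp_KIF_score_eq
    proof (rule sum_mono)
      fix k
      have "\<bar>scaled_tau (class_indices n \<omega> k) (sample_concordant j l \<omega>)\<bar> \<le> real (class_count n \<omega> k)"
        using abs_scaled_tau_le[OF finite_class_indices] by (simp add: class_count_eq)
      moreover have "\<bar>real (class_count n \<omega> k) * emp_kendall_tau n \<omega> j l\<bar> \<le> real (class_count n \<omega> k) * 1"
        unfolding abs_mult using False abs_emp_kendall_tau_le[of n \<omega> j l] by (intro mult_mono) auto
      ultimately show "\<bar>scaled_tau (class_indices n \<omega> k) (sample_concordant j l \<omega>)
          - real (class_count n \<omega> k) * emp_kendall_tau n \<omega> j l\<bar> \<le> 2 * real (class_count n \<omega> k)"
        by linarith
    qed
    also have "\<dots> \<le> real n * 2"
      using sum_class_count_le[of n \<omega> K] by (simp flip: sum_distrib_left)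
    finally show ?thesis
      using False by simp
  qed
qed

lemma abs_diff_abs_diff_le:
  fixes a a' b b' x y z :: real
  assumes "\<bar>a - a'\<bar> \<le> x" "\<bar>b - b'\<bar> \<le> y + z"
  shows "\<bar>\<bar>a - b\<bar> - \<bar>a' - b'\<bar>\<bar> \<le> x + z + y"
  using assms by linarith

text \<open>The account behind 14: the old and the new class of observation \<open>i\<close> each
  contribute 3 from the scaled tau and 1 from the class size, together 8, because the membership
  indicators sum to at most 1 over the classes. The overall tau moves by at most
  \<open>6 / n\<close>, and its weights, the class sizes, sum to at most \<open>n\<close>; this adds
  6. No step counts the classes.\<close>

lemma emp_KIF_score_bounded_diff:
  assumes i: "i \<in> {1..n}"
  shows "\<bar>emp_KIF_score n \<xi> K j l - emp_KIF_score n (\<xi>(i := z)) K j l\<bar> \<le> 14 / real n"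
proof -
  define \<xi>' where "\<xi>' = \<xi>(i := z)"
  have "n \<ge> 1" using i by auto
  let ?C = "\<lambda>k. class_indices n \<xi> k" and ?C' = "\<lambda>k. class_indices n \<xi>' k"
  let ?m = "\<lambda>k. real (class_count n \<xi> k)" and ?m' = "\<lambda>k. real (class_count n \<xi>' k)"
  let ?R = "sample_concordant j l \<xi>" and ?R' = "sample_concordant j l \<xi>'"
  let ?t = "emp_kendall_tau n \<xi> j l" and ?t' = "emp_kendall_tau n \<xi>' j l"
  let ?in = "\<lambda>k. of_bool (i \<in> ?C k) :: real" and ?in' = "\<lambda>k. of_bool (i \<in> ?C' k) :: real"
  have common: "?C k - {i} = ?C' k - {i}" for k
    by (auto simp: class_indices_def \<xi>'_def)
  have scaled: "\<bar>scaled_tau (?C k) ?R - scaled_tau (?C' k) ?R'\<bar> \<le> 3 * ?in k + 3 * ?in' k" for k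
  proof -
    have "scaled_tau (?C k - {i}) ?R = scaled_tau (?C' k - {i}) ?R'"
      unfolding common by (rule scaled_tau_cong) (simp add: \<xi>'_def)
    then show ?thesis
      using scaled_tau_remove_diff[OF finite_class_indices symp_sample_concordant, of n \<xi> k j l \<xi> i]
        scaled_tau_remove_diff[OF finite_class_indices symp_sample_concordant, of n \<xi>' k j l \<xi>' i]
      by linarith
  qed
  have count: "\<bar>?m k - ?m' k\<bar> \<le> ?in k + ?in' k" for k
  proof -
    have remove: "real (card C) = real (card (C - {i})) + of_bool (i \<in> C)" if "finite C" for C
    proof (cases "i \<in> C")
      case True
      then have "of_bool (i \<in> C) = (1::real)" by simp
      then show ?thesis
        by (metis card.remove[OF that True] of_nat_Suc add.commute)
    qed simp
    have "?m k = real (card (?C k - {i})) + ?in k" "?m' k = real (card (?C' k - {i})) + ?in' k"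
      unfolding class_count_eq by (rule remove, simp)+
    with common show ?thesis by simp
  qed
  have tau: "real n * \<bar>?t - ?t'\<bar> \<le> 6"
  proof -
    have "scaled_tau ({1..n} - {i}) ?R = scaled_tau ({1..n} - {i}) ?R'"
      by (rule scaled_tau_cong) (simp add: \<xi>'_def)
    then have "\<bar>scaled_tau {1..n} ?R - scaled_tau {1..n} ?R'\<bar> \<le> 6"
      using scaled_tau_remove_diff[of "{1..n}" ?R i] scaled_tau_remove_diff[of "{1..n}" ?R' i] i
        symp_sample_concordant[of j l \<xi>] symp_sample_concordant[of j l \<xi>']
      by simp
    moreover have "real n * \<bar>?t - ?t'\<bar> = \<bar>real n * ?t - real n * ?t'\<bar>"
      by (simp add: abs_mult right_diff_distrib[symmetric] del: right_diff_distrib)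
    ultimately show ?thesis
      by (simp only: scaled_tau_all[OF \<open>n \<ge> 1\<close>])
  qed
  have "real n * \<bar>emp_KIF_score n \<xi> K j l - emp_KIF_score n \<xi>' K j l\<bar>
      = \<bar>real n * emp_KIF_score n \<xi> K j l - real n * emp_KIF_score n \<xi>' K j l\<bar>"
    by (simp add: abs_mult right_diff_distrib[symmetric] del: right_diff_distrib)
  also have "\<dots> \<le> (\<Sum>k=1..K. \<bar>\<bar>scaled_tau (?C k) ?R - ?m k * ?t\<bar> - \<bar>scaled_tau (?C' k) ?R' - ?m' k * ?t'\<bar>\<bar>)"
    unfolding emp_KIF_score_eq sum_subtractf[symmetric] by (rule sum_abs)
  also have "\<dots> \<le> (\<Sum>k=1..K. 4 * (?in k + ?in' k) + ?m k * \<bar>?t - ?t'\<bar>)"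
  proof (rule sum_mono)
    fix k
    have "?m k * ?t - ?m' k * ?t' = ?m k * (?t - ?t') + (?m k - ?m' k) * ?t'"
      by (simp add: algebra_simps)
    also have "\<bar>\<dots>\<bar> \<le> ?m k * \<bar>?t - ?t'\<bar> + \<bar>?m k - ?m' k\<bar> * 1"
      using abs_emp_kendall_tau_le[OF \<open>n \<ge> 1\<close>, of \<xi>' j l]
      by (intro order.trans[OF abs_triangle_ineq] add_mono) (simp_all add: abs_mult mult_left_le)
    finally have "\<bar>?m k * ?t - ?m' k * ?t'\<bar> \<le> ?m k * \<bar>?t - ?t'\<bar> + \<bar>?m k - ?m' k\<bar>"
      by simp
    then have "\<bar>\<bar>scaled_tau (?C k) ?R - ?m k * ?t\<bar> - \<bar>scaled_tau (?C' k) ?R' - ?m' k * ?t'\<bar>\<bar>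
        \<le> (3 * ?in k + 3 * ?in' k) + \<bar>?m k - ?m' k\<bar> + ?m k * \<bar>?t - ?t'\<bar>"
      by (rule abs_diff_abs_diff_le[OF scaled])
    also have "\<dots> \<le> 4 * (?in k + ?in' k) + ?m k * \<bar>?t - ?t'\<bar>"
      using count[of k] by simp
    finally show "\<bar>\<bar>scaled_tau (?C k) ?R - ?m k * ?t\<bar> - \<bar>scaled_tau (?C' k) ?R' - ?m' k * ?t'\<bar>\<bar>
        \<le> 4 * (?in k + ?in' k) + ?m k * \<bar>?t - ?t'\<bar>" .
  qed
  also have "\<dots> = 4 * ((\<Sum>k=1..K. ?in k) + (\<Sum>k=1..K. ?in' k)) + (\<Sum>k=1..K. ?m k) * \<bar>?t - ?t'\<bar>"
    by (simp only: sum.distrib sum_distrib_left sum_distrib_right distrib_left)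
  also have "\<dots> \<le> 4 * (1 + 1) + real n * \<bar>?t - ?t'\<bar>"
    by (intro add_mono mult_left_mono mult_right_mono sum_of_bool_class_le sum_class_count_le) auto
  also have "\<dots> \<le> 14"
    using tau by simp
  finally show ?thesis
    using \<open>n \<ge> 1\<close> by (simp add: field_simps \<xi>'_def)
qed

section \<open>Second moments of U-statistics\<close>

locale iid_sample = prob_space D for D :: "'a measure" +
  fixes I :: "nat set"
  assumes finite_I: "finite I"
begin

abbreviation sample :: "(nat \<Rightarrow> 'a) measure" where
  "sample \<equiv> PiM I (\<lambda>_. D)"

end

sublocale iid_sample \<subseteq> S: finite_product_prob_space "\<lambda>_. D" "I"
  by unfold_locales (rule finite_I)

section \<open>Marginals and independence in an i.i.d. sample\<close>

context iid_sample
begin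

lemma distr_coordinate: "i \<in> I \<Longrightarrow> distr sample D (\<lambda>\<omega>. \<omega> i) = D"
  by (rule distr_PiM_component[where M="\<lambda>_. D"]) (rule prob_space_axioms)

lemma indep_coordinates:
  assumes "I \<noteq> {}"
  shows "S.indep_vars (\<lambda>_. D) (\<lambda>i \<omega>. \<omega> i) I"
proof (subst S.indep_vars_iff_distr_eq_PiM')
  have "distr sample sample (\<lambda>\<omega>. \<lambda>i\<in>I. \<omega> i) = distr sample sample (\<lambda>\<omega>. \<omega>)"
    by (intro distr_cong) (auto simp: space_PiM PiE_restrict)
  also have "\<dots> = PiM I (\<lambda>i. distr sample D (\<lambda>\<omega>. \<omega> i))"
    by (auto simp: distr_coordinate intro!: PiM_cong)
  finally show "distr sample sample (\<lambda>\<omega>. \<lambda>i\<in>I. \<omega> i) = PiM I (\<lambda>i. distr sample D (\<lambda>\<omega>. \<omega> i))" .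
qed (use assms in auto)

lemma distr_pair:
  assumes "i \<in> I" "t \<in> I" "i \<noteq> t"
  shows "distr sample (D \<Otimes>\<^sub>M D) (\<lambda>\<omega>. (\<omega> i, \<omega> t)) = D \<Otimes>\<^sub>M D"
proof -
  have "I \<noteq> {}" using assms by auto
  have "S.indep_var (PiM {i} (\<lambda>_. D)) (\<lambda>\<omega>. \<lambda>s\<in>{i}. \<omega> s) (PiM {t} (\<lambda>_. D)) (\<lambda>\<omega>. \<lambda>s\<in>{t}. \<omega> s)"
    by (rule S.indep_var_restrict[OF indep_coordinates[OF \<open>I \<noteq> {}\<close>]]) (use assms in auto)
  then have "S.indep_var D ((\<lambda>f. f i) \<circ> (\<lambda>\<omega>. \<lambda>s\<in>{i}. \<omega> s)) D ((\<lambda>f. f t) \<circ> (\<lambda>\<omega>. \<lambda>s\<in>{t}. \<omega> s))"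
    by (rule S.indep_var_compose) auto
  then have "S.indep_var D (\<lambda>\<omega>. \<omega> i) D (\<lambda>\<omega>. \<omega> t)"
    by (simp add: comp_def)
  then show ?thesis
    unfolding S.indep_var_distribution_eq
    using assms by (simp add: distr_coordinate)
qed

lemma expectation_pair:
  fixes g :: "'a \<Rightarrow> 'a \<Rightarrow> real"
  assumes "i \<in> I" "t \<in> I" "i \<noteq> t"
    and [measurable]: "case_prod g \<in> borel_measurable (D \<Otimes>\<^sub>M D)"
  shows "S.expectation (\<lambda>\<omega>. g (\<omega> i) (\<omega> t)) = (\<integral>z. case_prod g z \<partial>(D \<Otimes>\<^sub>M D))"
proof -
  have [measurable]: "(\<lambda>\<omega>. (\<omega> i, \<omega> t)) \<in> measurable sample (D \<Otimes>\<^sub>M D)"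
    using assms by measurable
  have "(\<integral>z. case_prod g z \<partial>(D \<Otimes>\<^sub>M D)) = (\<integral>z. case_prod g z \<partial>distr sample (D \<Otimes>\<^sub>M D) (\<lambda>\<omega>. (\<omega> i, \<omega> t)))"
    using assms by (simp add: distr_pair)
  also have "\<dots> = S.expectation (\<lambda>\<omega>. g (\<omega> i) (\<omega> t))"
    by (subst integral_distr) auto
  finally show ?thesis by simp
qed

lemma expectation_component:
  fixes g :: "'a \<Rightarrow> real"
  assumes "i \<in> I" and [measurable]: "g \<in> borel_measurable D"
  shows "S.expectation (\<lambda>\<omega>. g (\<omega> i)) = (\<integral>z. g z \<partial>D)"
proof -
  have [measurable]: "(\<lambda>\<omega>. \<omega> i) \<in> measurable sample D"
    using assms by measurable
  have "(\<integral>z. g z \<partial>D) = (\<integral>z. g z \<partial>distr sample D (\<lambda>\<omega>. \<omega> i))"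
    using assms by (simp add: distr_coordinate)
  also have "\<dots> = S.expectation (\<lambda>\<omega>. g (\<omega> i))"
    by (subst integral_distr) auto
  finally show ?thesis by simp
qed

text \<open>The equations with \<open>restrict\<close> express that \<open>F\<close> depends only on
  the coordinates in \<open>J\<close>, and \<open>G\<close> only on those in \<open>L\<close>. Both
  are thus functions of disjoint blocks of coordinates, which are independent.\<close>

lemma expectation_disjoint_mult:
  fixes F G :: "(nat \<Rightarrow> 'a) \<Rightarrow> real"
  assumes "J \<inter> L = {}" "J \<subseteq> I" "L \<subseteq> I" "I \<noteq> {}"
    and F: "F \<in> borel_measurable (PiM J (\<lambda>_. D))" "\<And>\<omega>. \<bar>F \<omega>\<bar> \<le> B" "\<And>\<omega>. F (restrict \<omega> J) = F \<omega>"
    and G: "G \<in> borel_measurable (PiM L (\<lambda>_. D))" "\<And>\<omega>. \<bar>G \<omega>\<bar> \<le> B'" "\<And>\<omega>. G (restrict \<omega> L) = G \<omega>"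
  shows "S.expectation (\<lambda>\<omega>. F \<omega> * G \<omega>) = S.expectation F * S.expectation G"
proof -
  have "S.indep_var (PiM J (\<lambda>_. D)) (\<lambda>\<omega>. \<lambda>s\<in>J. \<omega> s) (PiM L (\<lambda>_. D)) (\<lambda>\<omega>. \<lambda>s\<in>L. \<omega> s)"
    by (rule S.indep_var_restrict[OF indep_coordinates[OF \<open>I \<noteq> {}\<close>]]) (use assms in auto)
  then have "S.indep_var borel (F \<circ> (\<lambda>\<omega>. \<lambda>s\<in>J. \<omega> s)) borel (G \<circ> (\<lambda>\<omega>. \<lambda>s\<in>L. \<omega> s))"
    using F(1) G(1) by (rule S.indep_var_compose)
  then have indep: "S.indep_var borel F borel G"
    by (simp add: comp_def F(3) G(3))
  moreover have "integrable sample F" "integrable sample G"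
    using S.indep_var_rv1[OF indep] S.indep_var_rv2[OF indep] F(2) G(2)
    by (auto intro: S.integrable_const_bound[where B=B] S.integrable_const_bound[where B=B'])
  ultimately show ?thesis
    by (intro S.indep_var_lebesgue_integral)
qed

text \<open>A variance bound under local dependence. Expanding the square leaves the couples related
  by the dependency relation \<open>r\<close>, at most \<open>N\<close> for each \<open>p\<close>,
  each contributing at most \<open>c\<close>; the bound \<open>B\<close> provides integrability. It
  serves the class counts with \<open>r\<close> equality, and the pair sums with \<open>r\<close>
  meaning a shared index.\<close>

lemma second_moment_sum_le:
  fixes X :: "'b \<Rightarrow> (nat \<Rightarrow> 'a) \<Rightarrow> real"
  assumes "finite P"
    and meas: "\<And>p. p \<in> P \<Longrightarrow> X p \<in> borel_measurable sample"
    and bound: "\<And>p \<omega>. p \<in> P \<Longrightarrow> \<bar>X p \<omega>\<bar> \<le> B"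
    and cov: "\<And>p p'. p \<in> P \<Longrightarrow> p' \<in> P \<Longrightarrow>
        S.expectation (\<lambda>\<omega>. X p \<omega> * X p' \<omega>) \<le> c * of_bool (r p p')"
    and count: "\<And>p. p \<in> P \<Longrightarrow> real (card {p' \<in> P. r p p'}) \<le> N" and "c \<ge> 0"
  shows "S.expectation (\<lambda>\<omega>. (\<Sum>p\<in>P. X p \<omega>)\<^sup>2) \<le> real (card P) * (c * N)"
proof -
  have int: "integrable sample (\<lambda>\<omega>. X p \<omega> * X p' \<omega>)" if "p \<in> P" "p' \<in> P" for p p'
  proof (rule S.integrable_const_bound[where B="B * B"])
    show "AE \<omega> in sample. norm (X p \<omega> * X p' \<omega>) \<le> B * B"
      using bound[OF that(1)] bound[OF that(2)]
      by (auto simp: abs_mult intro!: AE_I2 mult_mono order.trans[OF abs_ge_zero bound[OF that(1)]])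
  qed (intro borel_measurable_times meas that)
  have "S.expectation (\<lambda>\<omega>. (\<Sum>p\<in>P. X p \<omega>)\<^sup>2) = S.expectation (\<lambda>\<omega>. \<Sum>p\<in>P. \<Sum>p'\<in>P. X p \<omega> * X p' \<omega>)"
    by (simp add: power2_eq_square sum_product)
  also have "\<dots> = (\<Sum>p\<in>P. \<Sum>p'\<in>P. S.expectation (\<lambda>\<omega>. X p \<omega> * X p' \<omega>))"
    using int by (simp add: Bochner_Integration.integral_sum Bochner_Integration.integrable_sum)
  also have "\<dots> \<le> (\<Sum>p\<in>P. \<Sum>p'\<in>P. c * of_bool (r p p'))"
    by (intro sum_mono cov)
  also have "\<dots> = (\<Sum>p\<in>P. c * real (card {p' \<in> P. r p p'}))"
    using \<open>finite P\<close> by (simp add: sum_distrib_left[symmetric] Int_def)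
  also have "\<dots> \<le> (\<Sum>p\<in>P. c * N)"
    using count \<open>c \<ge> 0\<close> by (intro sum_mono mult_left_mono)
  finally show ?thesis by simp
qed

end

text \<open>Multiplying by \<open>card C - 1\<close> clears the denominator. From size 2 on this is
  an equality, because \<open>C\<close> has \<open>m * (m - 1) / 2\<close> pairs. For sizes 0 and 1
  the left-hand side vanishes, so the default value of the tau there does no harm at this
  point.\<close>

lemma scaled_tau_deviation_le:
  assumes "finite C"
  shows "(real (card C) - 1) * \<bar>scaled_tau C R - real (card C) * (2 * u - 1)\<bar>
    \<le> 4 * \<bar>real (pair_count C R) - u * real (card {(i, t). i \<in> C \<and> t \<in> C \<and> i < t})\<bar>"
proof -
  consider "card C = 0" | "card C = 1" | "card C \<ge> 2"
    by linarith
  then show ?thesis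
  proof cases
    case 1
    then have "C = {}" using assms by simp
    then show ?thesis by (simp add: scaled_tau_def)
  next
    case 3
    define m where "m = real (card C)"
    have m: "m \<ge> 2" using 3 by (simp add: m_def)
    have pairs: "real (card {(i, t). i \<in> C \<and> t \<in> C \<and> i < t}) = m * (m - 1) / 2"
      using card_less_pairs[OF assms] by (simp add: m_def)
    have "(m - 1) * (scaled_tau C R - m * (2 * u - 1)) = 4 * (real (pair_count C R) - u * (m * (m - 1) / 2))"
      using m unfolding scaled_tau_def m_def[symmetric] by (simp add: field_simps)
    then have "(m - 1) * \<bar>scaled_tau C R - m * (2 * u - 1)\<bar> = 4 * \<bar>real (pair_count C R) - u * (m * (m - 1) / 2)\<bar>"
      using m by (metis abs_mult abs_of_nonneg abs_numeral diff_ge_0_iff_ge one_le_numeral order.trans)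
    then show ?thesis
      unfolding pairs m_def[symmetric] by simp
  qed simp
qed

text \<open>Integrated with \<open>t\<close> the square root of a bound on the second moment of
  \<open>y\<close>, this replaces the Cauchy-Schwarz inequality: the mean of
  \<open>\<bar>y\<bar>\<close> is at most \<open>t\<close>.\<close>

lemma two_abs_le:
  fixes y t :: real
  assumes "t > 0"
  shows "2 * \<bar>y\<bar> \<le> y\<^sup>2 / t + t"
proof -
  have "2 * \<bar>y\<bar> * t \<le> y\<^sup>2 + t\<^sup>2"
    using zero_le_power2[of "\<bar>y\<bar> - t"] by (simp add: power2_diff)
  with assms show ?thesis
    by (simp add: field_simps power2_eq_square)
qed

text \<open>Clears the random denominator \<open>m - 1\<close> of \<open>scaled_tau\<close> by trading \<open>m\<close> for its mean \<open>\<mu>\<close>, which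
  leaves only terms controlled by second moments; \<open>s\<close> and \<open>r\<close> are AM-GM weights.\<close>

lemma deviation_quadratic_bound:
  fixes x m \<mu> a s r :: real
  assumes "(m - 1) * x \<le> 4 * \<bar>a\<bar>" "0 \<le> x" "x \<le> 2 * m" "\<mu> \<ge> 0" "s > 0" "r > 0"
  shows "\<mu> * x \<le> 2 * (a\<^sup>2 / s + s) + ((m - \<mu>)\<^sup>2 / r + r) * \<mu> + 2 * (m - \<mu>)\<^sup>2 + 2 * m"
proof -
  have "(\<mu> - m) * x \<le> \<bar>m - \<mu>\<bar> * (2 * m)"
  proof -
    have "\<bar>\<mu> - m\<bar> * x \<le> \<bar>\<mu> - m\<bar> * (2 * m)"
      using assms by (intro mult_left_mono) auto
    moreover have "(\<mu> - m) * x \<le> \<bar>\<mu> - m\<bar> * x"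
      using assms by (intro mult_right_mono) auto
    ultimately show ?thesis
      by (simp add: abs_minus_commute)
  qed
  also have "\<dots> = 2 * (\<bar>m - \<mu>\<bar> * (m - \<mu>)) + 2 * \<bar>m - \<mu>\<bar> * \<mu>"
    by (simp add: algebra_simps)
  finally have 1: "(\<mu> - m) * x \<le> 2 * (\<bar>m - \<mu>\<bar> * (m - \<mu>)) + 2 * \<bar>m - \<mu>\<bar> * \<mu>" .
  have "\<bar>m - \<mu>\<bar> * (m - \<mu>) \<le> \<bar>m - \<mu>\<bar> * \<bar>m - \<mu>\<bar>"
    by (intro mult_left_mono) auto
  then have 2: "\<bar>m - \<mu>\<bar> * (m - \<mu>) \<le> (m - \<mu>)\<^sup>2"
    by (simp add: power2_eq_square)
  have 3: "2 * \<bar>m - \<mu>\<bar> * \<mu> \<le> ((m - \<mu>)\<^sup>2 / r + r) * \<mu>"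
    by (rule mult_right_mono[OF two_abs_le[OF \<open>r > 0\<close>] \<open>\<mu> \<ge> 0\<close>])
  \<comment> \<open>The three summands are controlled by the pair sum, by the deviation of the class
    size from its mean, and by \<open>x \<le> 2 * m\<close>; the last one pays for the denominator
    being \<open>m - 1\<close> and not \<open>m\<close>.\<close>
  have 4: "\<mu> * x = (m - 1) * x + (\<mu> - m) * x + x"
    by (simp add: algebra_simps)
  have combine: "v \<le> 2 * a' + c + 2 * b + 2 * m"
    if "t \<le> 2 * p + d" "p \<le> b" "d \<le> c" "2 * z \<le> a'" "v = u + t + x" "u \<le> 4 * z"
    for a' b c d p t u v z :: real
    using that \<open>x \<le> 2 * m\<close> by linarith
  show ?thesis
    by (rule combine[OF 1 2 3 two_abs_le[OF \<open>s > 0\<close>] 4 assms(1)])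
qed

section \<open>The U-statistic of a class\<close>

context iid_sample
begin

text \<open>Taking \<open>B\<close> to be the whole space gives the unconditional probability of
  concordance, so the class taus and the overall tau are covered by one estimate.\<close>

definition cond_concordance :: "('a \<Rightarrow> 'a \<Rightarrow> bool) \<Rightarrow> 'a set \<Rightarrow> real" where
  "cond_concordance h B =
     measure (D \<Otimes>\<^sub>M D) {(a, b) \<in> space (D \<Otimes>\<^sub>M D). h a b \<and> a \<in> B \<and> b \<in> B} / (prob B)\<^sup>2"

text \<open>The indicators turn a sum over a class of random size into a sum over all index pairs.
  The centring constant is multiplied by the indicators too: the sum then compares the concordant
  pairs of the class with the actual number of its pairs, not with the expected number.\<close>

definition centered_kernel :: "('a \<Rightarrow> 'a \<Rightarrow> bool) \<Rightarrow> 'a set \<Rightarrow> 'a \<Rightarrow> 'a \<Rightarrow> real" where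
  "centered_kernel h B a b = indicat_real B a * indicat_real B b * (of_bool (h a b) - cond_concordance h B)"

definition indices_in :: "'a set \<Rightarrow> (nat \<Rightarrow> 'a) \<Rightarrow> nat set" where
  "indices_in B \<omega> = {i \<in> I. \<omega> i \<in> B}"

abbreviation index_pairs :: "(nat \<times> nat) set" where
  "index_pairs \<equiv> {(i, t). i \<in> I \<and> t \<in> I \<and> i < t}"

lemma finite_index_pairs: "finite index_pairs"
  by (rule finite_subset[of _ "I \<times> I"]) (use finite_I in auto)

interpretation DD: prob_space "D \<Otimes>\<^sub>M D"
  by (rule prob_space_pair) (rule prob_space_axioms)+

lemma measure_square:
  assumes "B \<in> sets D"
  shows "measure (D \<Otimes>\<^sub>M D) (B \<times> B) = (prob B)\<^sup>2"
proof -
  have "emeasure (D \<Otimes>\<^sub>M D) (B \<times> B) = emeasure D B * emeasure D B"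
    using assms by (intro emeasure_pair_measure_Times)
  then show ?thesis
    by (simp add: emeasure_eq_measure DD.emeasure_eq_measure power2_eq_square flip: ennreal_mult)
qed

lemma coordinate_measurable: "i \<in> I \<Longrightarrow> (\<lambda>\<omega>. \<omega> i) \<in> measurable sample D"
  by measurable

lemma finite_indices_in [simp]: "finite (indices_in B \<omega>)"
  using finite_I by (simp add: indices_in_def)

lemma card_indices_in: "real (card (indices_in B \<omega>)) = (\<Sum>i\<in>I. indicat_real B (\<omega> i))"
proof -
  have "(\<Sum>i\<in>I. indicat_real B (\<omega> i)) = (\<Sum>i\<in>I. of_bool (\<omega> i \<in> B))"
    by (intro sum.cong) (auto simp: indicator_def)
  then show ?thesis
    using finite_I by (simp add: indices_in_def Int_def)
qed

lemma card_indices_in_le: "real (card (indices_in B \<omega>)) \<le> real (card I)"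
  using finite_I by (auto intro!: card_mono simp: indices_in_def)

lemma card_indices_in_measurable:
  assumes "B \<in> sets D"
  shows "(\<lambda>\<omega>. real (card (indices_in B \<omega>))) \<in> borel_measurable sample"
  unfolding card_indices_in
  using assms by (intro borel_measurable_sum measurable_compose[OF coordinate_measurable]) auto

lemma pair_count_indices_in:
  "real (pair_count (indices_in B \<omega>) (\<lambda>i t. Q (\<omega> i) (\<omega> t)))
     = (\<Sum>(i, t)\<in>index_pairs. indicat_real B (\<omega> i) * indicat_real B (\<omega> t) * of_bool (Q (\<omega> i) (\<omega> t)))"
proof -
  have "(\<Sum>(i, t)\<in>index_pairs. indicat_real B (\<omega> i) * indicat_real B (\<omega> t) * of_bool (Q (\<omega> i) (\<omega> t)))
     = (\<Sum>p\<in>index_pairs. of_bool (\<omega> (fst p) \<in> B \<and> \<omega> (snd p) \<in> B \<and> Q (\<omega> (fst p)) (\<omega> (snd p))))"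
    by (intro sum.cong) (auto simp: indicator_def)
  also have "\<dots> = real (card (index_pairs \<inter>
      {p. \<omega> (fst p) \<in> B \<and> \<omega> (snd p) \<in> B \<and> Q (\<omega> (fst p)) (\<omega> (snd p))}))"
    using finite_index_pairs by simp
  also have "index_pairs \<inter> {p. \<omega> (fst p) \<in> B \<and> \<omega> (snd p) \<in> B \<and> Q (\<omega> (fst p)) (\<omega> (snd p))}
      = {(i, t). i \<in> indices_in B \<omega> \<and> t \<in> indices_in B \<omega> \<and> i < t \<and> Q (\<omega> i) (\<omega> t)}"
    by (auto simp: indices_in_def)
  finally show ?thesis
    by (simp add: pair_count_def)
qed

text \<open>The variance of a binomial count, bounded by its mean; independence removes the terms
  off the diagonal.\<close>

lemma second_moment_count:
  assumes B [measurable]: "B \<in> sets D"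
  shows "S.expectation (\<lambda>\<omega>. ((\<Sum>i\<in>I. indicat_real B (\<omega> i)) - real (card I) * prob B)\<^sup>2) \<le> real (card I) * prob B"
proof -
  have coord [measurable]: "(\<lambda>\<omega>. \<omega> i) \<in> measurable (PiM J (\<lambda>_. D)) D" if "i \<in> J" for i J
    using that by measurable
  have mean: "S.expectation (\<lambda>\<omega>. indicat_real B (\<omega> i) - prob B) = 0" if "i \<in> I" for i
    using that by (subst expectation_component) (auto simp: Bochner_Integration.integral_diff emeasure_eq_measure prob_space)
  have prob_le: "0 \<le> prob B" "prob B \<le> 1"
    by auto
  have bound: "\<bar>indicat_real B a - prob B\<bar> \<le> 1" for a
  proof -
    have "0 \<le> indicat_real B a" "indicat_real B a \<le> 1"
      by (simp_all add: indicator_def)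
    with prob_le show ?thesis by linarith
  qed
  have "S.expectation (\<lambda>\<omega>. (\<Sum>i\<in>I. indicat_real B (\<omega> i) - prob B)\<^sup>2) \<le> real (card I) * (prob B * 1)"
  proof (rule second_moment_sum_le[OF finite_I, where r="(=)" and B=1])
    fix i t assume it: "i \<in> I" "t \<in> I"
    show "S.expectation (\<lambda>\<omega>. (indicat_real B (\<omega> i) - prob B) * (indicat_real B (\<omega> t) - prob B))
        \<le> prob B * of_bool (i = t)"
    proof (cases "i = t")
      case False
      have "S.expectation (\<lambda>\<omega>. (indicat_real B (\<omega> i) - prob B) * (indicat_real B (\<omega> t) - prob B))
        = S.expectation (\<lambda>\<omega>. indicat_real B (\<omega> i) - prob B) * S.expectation (\<lambda>\<omega>. indicat_real B (\<omega> t) - prob B)"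
        by (rule expectation_disjoint_mult[of "{i}" "{t}"]) (use it False bound in auto)
      with False mean[OF it(1)] show ?thesis by simp
    next
      case True
      have "S.expectation (\<lambda>\<omega>. (indicat_real B (\<omega> i) - prob B) * (indicat_real B (\<omega> i) - prob B))
          = (\<integral>a. (indicat_real B a - prob B) * (indicat_real B a - prob B) \<partial>D)"
        using it by (intro expectation_component[where g="\<lambda>a. (indicat_real B a - prob B) * (indicat_real B a - prob B)"]) auto
      also have "\<dots> = (\<integral>a. (1 - 2 * prob B) * indicat_real B a + (prob B)\<^sup>2 \<partial>D)"
        by (intro Bochner_Integration.integral_cong)
          (auto simp: indicator_def power2_eq_square algebra_simps)
      also have "\<dots> = (1 - 2 * prob B) * prob B + (prob B)\<^sup>2"
        by (subst Bochner_Integration.integral_add) (auto simp: emeasure_eq_measure prob_space)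
      also have "\<dots> \<le> prob B"
        by (simp add: power2_eq_square algebra_simps)
      finally show ?thesis
        using True by simp
    qed
  next
    fix i
    have "card {t \<in> I. i = t} \<le> card {i}"
      by (intro card_mono) auto
    then show "real (card {t \<in> I. i = t}) \<le> 1" by simp
  qed (use bound in auto)
  also have "(\<lambda>\<omega>. \<Sum>i\<in>I. indicat_real B (\<omega> i) - prob B) = (\<lambda>\<omega>. (\<Sum>i\<in>I. indicat_real B (\<omega> i)) - real (card I) * prob B)"
    by (simp add: sum_subtractf)
  finally show ?thesis by simp
qed

lemma integrable_count_deviation:
  assumes [measurable]: "B \<in> sets D"
  shows "integrable sample (\<lambda>\<omega>. \<bar>real (card (indices_in B \<omega>)) - c\<bar>)"
proof -
  note [measurable] = card_indices_in_measurable[OF assms]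
  show ?thesis
  proof (rule S.integrable_const_bound[where B="real (card I) + \<bar>c\<bar>"])
    have "\<bar>real (card (indices_in B \<omega>)) - c\<bar> \<le> real (card I) + \<bar>c\<bar>" for \<omega>
      using card_indices_in_le[of B \<omega>] by linarith
    then show "AE \<omega> in sample. norm \<bar>real (card (indices_in B \<omega>)) - c\<bar> \<le> real (card I) + \<bar>c\<bar>"
      by simp
  qed measurable
qed

text \<open>AM-GM with weight \<open>sqrt N\<close>, which fits the second moment bound
  \<open>N * prob B \<le> N\<close>.\<close>

lemma expectation_count_deviation_le:
  assumes [measurable]: "B \<in> sets D" and "I \<noteq> {}"
  shows "S.expectation (\<lambda>\<omega>. \<bar>real (card (indices_in B \<omega>)) - real (card I) * prob B\<bar>) \<le> sqrt (real (card I))"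
proof -
  define N where "N = real (card I)"
  define y where "y \<omega> = real (card (indices_in B \<omega>)) - N * prob B" for \<omega>
  have "card I \<ge> 1"
    using assms finite_I by (simp add: Suc_le_eq card_gt_0_iff)
  then have N: "N \<ge> 1" by (simp add: N_def)
  have int_abs: "integrable sample (\<lambda>\<omega>. \<bar>y \<omega>\<bar>)"
    unfolding y_def by (rule integrable_count_deviation[OF assms(1)])
  have y_bound: "\<bar>y \<omega>\<bar> \<le> N" for \<omega>
  proof -
    have "0 \<le> N * prob B" "N * prob B \<le> N"
      using N by (simp_all add: mult_left_le)
    with card_indices_in_le[of B \<omega>] show ?thesis
      unfolding y_def N_def by linarith
  qed
  have int_sq: "integrable sample (\<lambda>\<omega>. (y \<omega>)\<^sup>2)"
  proof (rule S.integrable_const_bound)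
    show "AE \<omega> in sample. norm ((y \<omega>)\<^sup>2) \<le> N\<^sup>2"
      using power_mono[OF y_bound abs_ge_zero, where n=2] by (intro AE_I2) simp
    show "(\<lambda>\<omega>. (y \<omega>)\<^sup>2) \<in> borel_measurable sample"
      using card_indices_in_measurable[OF assms(1)] unfolding y_def by measurable
  qed
  have "2 * S.expectation (\<lambda>\<omega>. \<bar>y \<omega>\<bar>) = S.expectation (\<lambda>\<omega>. 2 * \<bar>y \<omega>\<bar>)"
    by simp
  also have "\<dots> \<le> S.expectation (\<lambda>\<omega>. (y \<omega>)\<^sup>2 / sqrt N + sqrt N)"
    using N int_abs int_sq by (intro integral_mono two_abs_le) auto
  also have "\<dots> = S.expectation (\<lambda>\<omega>. (y \<omega>)\<^sup>2) / sqrt N + sqrt N"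
    using int_sq by (simp add: S.P.prob_space)
  also have "\<dots> \<le> N / sqrt N + sqrt N"
  proof (intro add_mono divide_right_mono)
    have "S.expectation (\<lambda>\<omega>. (y \<omega>)\<^sup>2) \<le> N * prob B"
      using second_moment_count[OF assms(1)] by (simp add: y_def N_def card_indices_in)
    also have "\<dots> \<le> N"
      using N by (simp add: mult_left_le)
    finally show "S.expectation (\<lambda>\<omega>. (y \<omega>)\<^sup>2) \<le> N" .
  qed (use N in auto)
  also have "\<dots> = 2 * sqrt N"
    using N by (simp add: real_div_sqrt)
  finally show ?thesis
    by (simp add: y_def N_def)
qed

context
  fixes h :: "'a \<Rightarrow> 'a \<Rightarrow> bool" and B :: "'a set"
  assumes h [measurable]: "Measurable.pred (D \<Otimes>\<^sub>M D) (\<lambda>(a, b). h a b)"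
    and B [measurable]: "B \<in> sets D"
    and prob_B: "prob B > 0"
begin

lemma concordant_set_measurable [measurable]:
  "{(a, b) \<in> space (D \<Otimes>\<^sub>M D). h a b \<and> a \<in> B \<and> b \<in> B} \<in> sets (D \<Otimes>\<^sub>M D)"
proof -
  have "{(a, b) \<in> space (D \<Otimes>\<^sub>M D). h a b \<and> a \<in> B \<and> b \<in> B}
      = {z \<in> space (D \<Otimes>\<^sub>M D). (\<lambda>(a, b). h a b) z} \<inter> B \<times> B"
    using sets.sets_into_space[OF B] by (auto simp: space_pair_measure)
  then show ?thesis by simp
qed

lemma cond_concordance_bounds: "0 \<le> cond_concordance h B" "cond_concordance h B \<le> 1"
proof -
  have "measure (D \<Otimes>\<^sub>M D) {(a, b) \<in> space (D \<Otimes>\<^sub>M D). h a b \<and> a \<in> B \<and> b \<in> B} \<le> measure (D \<Otimes>\<^sub>M D) (B \<times> B)"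
    by (rule DD.finite_measure_mono) auto
  then show "cond_concordance h B \<le> 1"
    using prob_B by (simp add: cond_concordance_def measure_square[OF B])
qed (simp add: cond_concordance_def)

lemma centered_kernel_measurable [measurable]:
  "case_prod (centered_kernel h B) \<in> borel_measurable (D \<Otimes>\<^sub>M D)"
  unfolding centered_kernel_def by measurable

lemma abs_centered_kernel_le: "\<bar>centered_kernel h B a b\<bar> \<le> indicat_real B a * indicat_real B b"
  using cond_concordance_bounds by (auto simp: centered_kernel_def indicator_def)

lemma abs_centered_kernel_le_1: "\<bar>centered_kernel h B a b\<bar> \<le> 1"
  by (rule order.trans[OF abs_centered_kernel_le]) (simp add: indicator_def)

lemma integral_centered_kernel: "(\<integral>z. case_prod (centered_kernel h B) z \<partial>(D \<Otimes>\<^sub>M D)) = 0"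
proof -
  let ?E = "{(a, b) \<in> space (D \<Otimes>\<^sub>M D). h a b \<and> a \<in> B \<and> b \<in> B}"
  have "(\<integral>z. case_prod (centered_kernel h B) z \<partial>(D \<Otimes>\<^sub>M D))
      = (\<integral>z. indicat_real ?E z - cond_concordance h B * indicat_real (B \<times> B) z \<partial>(D \<Otimes>\<^sub>M D))"
    by (intro Bochner_Integration.integral_cong) (auto simp: centered_kernel_def indicator_def)
  also have "\<dots> = measure (D \<Otimes>\<^sub>M D) ?E - cond_concordance h B * measure (D \<Otimes>\<^sub>M D) (B \<times> B)"
    by (subst Bochner_Integration.integral_diff) (auto simp: DD.emeasure_eq_measure less_top[symmetric])
  also have "\<dots> = 0"
    using prob_B by (simp add: measure_square[OF B] cond_concordance_def)
  finally show ?thesis .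
qed

lemma kernel_pair_measurable:
  assumes "i \<in> J" "t \<in> J"
  shows "(\<lambda>\<omega>. centered_kernel h B (\<omega> i) (\<omega> t)) \<in> borel_measurable (PiM J (\<lambda>_. D))"
proof -
  have "(\<lambda>\<omega>. (\<omega> i, \<omega> t)) \<in> measurable (PiM J (\<lambda>_. D)) (D \<Otimes>\<^sub>M D)"
    using assms by measurable
  from measurable_compose[OF this centered_kernel_measurable] show ?thesis
    by simp
qed

text \<open>Disjoint pairs are independent and the kernel has mean zero. For overlapping pairs one
  factor is bounded by 1 and the other by the indicators of its two observations lying in
  \<open>B\<close>, which leaves \<open>(prob B)^2\<close>. This power of \<open>prob B\<close> is
  what makes the final estimate uniform over the classes.\<close>

lemma kernel_covariance_le:
  assumes "i \<in> I" "t \<in> I" "i \<noteq> t" "i' \<in> I" "t' \<in> I" "i' \<noteq> t'"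
  shows "S.expectation (\<lambda>\<omega>. centered_kernel h B (\<omega> i) (\<omega> t) * centered_kernel h B (\<omega> i') (\<omega> t'))
    \<le> (prob B)\<^sup>2 * of_bool ({i, t} \<inter> {i', t'} \<noteq> {})"
proof (cases "{i, t} \<inter> {i', t'} = {}")
  case True
  have "S.expectation (\<lambda>\<omega>. centered_kernel h B (\<omega> i) (\<omega> t) * centered_kernel h B (\<omega> i') (\<omega> t'))
      = S.expectation (\<lambda>\<omega>. centered_kernel h B (\<omega> i) (\<omega> t)) * S.expectation (\<lambda>\<omega>. centered_kernel h B (\<omega> i') (\<omega> t'))"
    by (rule expectation_disjoint_mult[OF True]) (use assms abs_centered_kernel_le_1 in \<open>auto intro: kernel_pair_measurable\<close>)
  also have "\<dots> = 0"
    using expectation_pair[OF assms(1-3) centered_kernel_measurable] integral_centered_kernel by simp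
  finally show ?thesis
    using True by simp
next
  case False
  have [measurable]: "(\<lambda>\<omega>. centered_kernel h B (\<omega> i) (\<omega> t)) \<in> borel_measurable sample"
    "(\<lambda>\<omega>. centered_kernel h B (\<omega> i') (\<omega> t')) \<in> borel_measurable sample"
    using assms by (auto intro: kernel_pair_measurable)
  have [measurable]: "(\<lambda>\<omega>. \<omega> i) \<in> measurable sample D" "(\<lambda>\<omega>. \<omega> t) \<in> measurable sample D"
    using assms by auto
  have le: "\<bar>centered_kernel h B a b * centered_kernel h B a' b'\<bar> \<le> indicat_real B a * indicat_real B b" for a b a' b'
  proof -
    have "\<bar>centered_kernel h B a b * centered_kernel h B a' b'\<bar> \<le> \<bar>centered_kernel h B a b\<bar> * 1"
      unfolding abs_mult by (intro mult_left_mono abs_centered_kernel_le_1) simp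
    then show ?thesis
      using abs_centered_kernel_le[of a b] by simp
  qed
  have "S.expectation (\<lambda>\<omega>. centered_kernel h B (\<omega> i) (\<omega> t) * centered_kernel h B (\<omega> i') (\<omega> t'))
      \<le> S.expectation (\<lambda>\<omega>. indicat_real B (\<omega> i) * indicat_real B (\<omega> t))"
  proof (rule integral_mono)
    show "integrable sample (\<lambda>\<omega>. centered_kernel h B (\<omega> i) (\<omega> t) * centered_kernel h B (\<omega> i') (\<omega> t'))"
      by (rule S.integrable_const_bound[where B=1])
        (auto intro!: order.trans[OF le] simp: indicator_def)
    show "integrable sample (\<lambda>\<omega>. indicat_real B (\<omega> i) * indicat_real B (\<omega> t))"
      by (rule S.integrable_const_bound[where B=1]) (auto simp: indicator_def)
  qed (use order.trans[OF abs_ge_self le] in auto)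
  also have "\<dots> = (\<integral>z. (\<lambda>(a, b). indicat_real B a * indicat_real B b) z \<partial>(D \<Otimes>\<^sub>M D))"
    by (rule expectation_pair[OF assms(1-3)]) measurable
  also have "\<dots> = (\<integral>z. indicat_real (B \<times> B) z \<partial>(D \<Otimes>\<^sub>M D))"
    by (intro Bochner_Integration.integral_cong) (auto simp: indicator_def)
  also have "\<dots> = (prob B)\<^sup>2"
    by (simp add: measure_square[OF B])
  finally show ?thesis
    using False by simp
qed

text \<open>There are at most \<open>N^2\<close> index pairs for \<open>N = card I\<close>, and each
  shares an index with at most \<open>4 * N\<close> of them: two choices of the shared index, two
  positions for it, \<open>N\<close> values for the other entry.\<close>

lemma second_moment_kernel_sum:
  "S.expectation (\<lambda>\<omega>. (\<Sum>(i, t)\<in>index_pairs. centered_kernel h B (\<omega> i) (\<omega> t))\<^sup>2)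
     \<le> 4 * real (card I) ^ 3 * (prob B)\<^sup>2"
proof -
  have sub: "index_pairs \<subseteq> I \<times> I" by auto
  have fin: "finite index_pairs"
    using sub finite_I by (auto intro: finite_subset)
  have card: "card index_pairs \<le> card I * card I"
    using card_mono[OF _ sub] finite_I by (simp add: card_cartesian_product)
  have "S.expectation (\<lambda>\<omega>. (\<Sum>p\<in>index_pairs. (\<lambda>(i, t). centered_kernel h B (\<omega> i) (\<omega> t)) p)\<^sup>2)
      \<le> real (card index_pairs) * ((prob B)\<^sup>2 * (4 * real (card I)))"
  proof (rule second_moment_sum_le[OF fin,
        where r="\<lambda>p p'. {fst p, snd p} \<inter> {fst p', snd p'} \<noteq> {}" and B=1])
    fix p p' assume "p \<in> index_pairs" "p' \<in> index_pairs"
    then show "S.expectation (\<lambda>\<omega>. (case p of (i, t) \<Rightarrow> centered_kernel h B (\<omega> i) (\<omega> t)) *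
        (case p' of (i, t) \<Rightarrow> centered_kernel h B (\<omega> i) (\<omega> t)))
        \<le> (prob B)\<^sup>2 * of_bool ({fst p, snd p} \<inter> {fst p', snd p'} \<noteq> {})"
      using kernel_covariance_le[of "fst p" "snd p" "fst p'" "snd p'"]
      by (auto simp: case_prod_unfold)
  next
    fix p assume p: "p \<in> index_pairs"
    let ?e = "{fst p, snd p}"
    have "card {p' \<in> index_pairs. ?e \<inter> {fst p', snd p'} \<noteq> {}} \<le> card (?e \<times> I \<union> I \<times> ?e)"
      using finite_I by (intro card_mono) auto
    also have "\<dots> \<le> card ?e * card I + card I * card ?e"
      using card_Un_le[of "?e \<times> I" "I \<times> ?e"] by (simp only: card_cartesian_product)
    also have "\<dots> \<le> 2 * card I + card I * 2"
      by (intro add_mono mult_mono) (auto simp: card_insert_if)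
    finally show "real (card {p' \<in> index_pairs. ?e \<inter> {fst p', snd p'} \<noteq> {}}) \<le> 4 * real (card I)"
      by simp
  qed (auto intro: kernel_pair_measurable simp: abs_centered_kernel_le_1)
  also have "\<dots> \<le> real (card I * card I) * ((prob B)\<^sup>2 * (4 * real (card I)))"
    using card by (intro mult_right_mono of_nat_mono) auto
  finally show ?thesis
    by (simp add: power3_eq_cube mult_ac)
qed

abbreviation sample_rel :: "(nat \<Rightarrow> 'a) \<Rightarrow> nat \<Rightarrow> nat \<Rightarrow> bool" where
  "sample_rel \<omega> \<equiv> (\<lambda>i t. h (\<omega> i) (\<omega> t))"

text \<open>Identifies the sum whose second moment is known with the quantity on the right of
  \<open>scaled_tau_deviation_le\<close>, for \<open>u\<close> the conditional probability of
  concordance.\<close>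

lemma centered_kernel_sum:
  "(\<Sum>(i, t)\<in>index_pairs. centered_kernel h B (\<omega> i) (\<omega> t))
     = real (pair_count (indices_in B \<omega>) (sample_rel \<omega>))
       - cond_concordance h B * real (card {(i, t). i \<in> indices_in B \<omega> \<and> t \<in> indices_in B \<omega> \<and> i < t})"
proof -
  have "(\<Sum>(i, t)\<in>index_pairs. centered_kernel h B (\<omega> i) (\<omega> t))
     = (\<Sum>(i, t)\<in>index_pairs. indicat_real B (\<omega> i) * indicat_real B (\<omega> t) * of_bool (h (\<omega> i) (\<omega> t)))
       - cond_concordance h B * (\<Sum>(i, t)\<in>index_pairs. indicat_real B (\<omega> i) * indicat_real B (\<omega> t) * of_bool True)"
    by (simp add: centered_kernel_def case_prod_unfold sum_distrib_left sum_subtractf[symmetric] algebra_simps)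
  then show ?thesis
    unfolding pair_count_indices_in[symmetric] pair_count_indices_in[of _ _ "\<lambda>_ _. True", symmetric]
    by (simp add: pair_count_def)
qed

declare card_indices_in_measurable [OF B, measurable]

lemma scaled_tau_measurable [measurable]:
  "(\<lambda>\<omega>. scaled_tau (indices_in B \<omega>) (sample_rel \<omega>)) \<in> borel_measurable sample"
proof -
  have "(\<lambda>\<omega>. real (pair_count (indices_in B \<omega>) (sample_rel \<omega>))) \<in> borel_measurable sample"
    unfolding pair_count_indices_in
  proof (rule borel_measurable_sum)
    fix p assume "p \<in> index_pairs"
    then have [measurable]: "(\<lambda>\<omega>. \<omega> (fst p)) \<in> measurable sample D" "(\<lambda>\<omega>. \<omega> (snd p)) \<in> measurable sample D"
      by (auto intro: coordinate_measurable)
    have "(\<lambda>(a, b). indicat_real B a * indicat_real B b * of_bool (h a b)) \<in> borel_measurable (D \<Otimes>\<^sub>M D)"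
      by measurable
    from measurable_compose[OF measurable_Pair[of "\<lambda>\<omega>. \<omega> (fst p)" _ _ "\<lambda>\<omega>. \<omega> (snd p)"] this]
    show "(\<lambda>\<omega>. case p of (i, t) \<Rightarrow> indicat_real B (\<omega> i) * indicat_real B (\<omega> t) * of_bool (h (\<omega> i) (\<omega> t)))
        \<in> borel_measurable sample"
      by (simp add: case_prod_unfold)
  qed
  then show ?thesis
    unfolding scaled_tau_def by measurable
qed

lemma abs_scaled_tau_deviation_le:
  "\<bar>scaled_tau (indices_in B \<omega>) R - real (card (indices_in B \<omega>)) * (2 * cond_concordance h B - 1)\<bar>
     \<le> 2 * real (card (indices_in B \<omega>))"
proof -
  have "\<bar>real (card (indices_in B \<omega>)) * (2 * cond_concordance h B - 1)\<bar> \<le> real (card (indices_in B \<omega>)) * 1"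
    unfolding abs_mult using cond_concordance_bounds by (intro mult_mono) auto
  then show "\<bar>scaled_tau (indices_in B \<omega>) R - real (card (indices_in B \<omega>)) * (2 * cond_concordance h B - 1)\<bar>
     \<le> 2 * real (card (indices_in B \<omega>))"
    using abs_scaled_tau_le[OF finite_indices_in, of B \<omega> R] by linarith
qed

lemma integrable_scaled_tau_deviation:
  "integrable sample (\<lambda>\<omega>. \<bar>scaled_tau (indices_in B \<omega>) (sample_rel \<omega>)
     - real (card (indices_in B \<omega>)) * (2 * cond_concordance h B - 1)\<bar>)"
proof (rule S.integrable_const_bound[where B="2 * real (card I)"])
  have "\<bar>scaled_tau (indices_in B \<omega>) (sample_rel \<omega>) - real (card (indices_in B \<omega>)) * (2 * cond_concordance h B - 1)\<bar>
      \<le> 2 * real (card I)" for \<omega>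
    using abs_scaled_tau_deviation_le[of \<omega> "sample_rel \<omega>"] card_indices_in_le[of B \<omega>] by linarith
  then show "AE \<omega> in sample. norm \<bar>scaled_tau (indices_in B \<omega>) (sample_rel \<omega>)
     - real (card (indices_in B \<omega>)) * (2 * cond_concordance h B - 1)\<bar> \<le> 2 * real (card I)"
    by simp
qed measurable

text \<open>The deviation is multiplied by the mean class size \<open>N * q\<close>, bounded
  pointwise by \<open>deviation_quadratic_bound\<close> and integrated. Every resulting term carries
  a factor \<open>N * q\<close>, and cancelling it leaves a bound free of \<open>q\<close>, valid
  also for classes of expected size below 1.\<close>

lemma expectation_scaled_tau_deviation_le:
  assumes "I \<noteq> {}"
  shows "S.expectation (\<lambda>\<omega>. \<bar>scaled_tau (indices_in B \<omega>) (sample_rel \<omega>)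
     - real (card (indices_in B \<omega>)) * (2 * cond_concordance h B - 1)\<bar>) \<le> 14 * sqrt (real (card I))"
proof -
  define N where "N = real (card I)"
  define q where "q = prob B"
  \<comment> \<open>The square root of the second moment bound \<open>4 * N^3 * q^2\<close> for the
    pair sum, so that the terms \<open>a^2 / s\<close> and \<open>s\<close> balance in the mean. For
    the class size the weight \<open>sqrt N\<close> plays this part.\<close>
  define s where "s = 2 * N * sqrt N * q"
  define x where "x \<omega> = \<bar>scaled_tau (indices_in B \<omega>) (sample_rel \<omega>)
     - real (card (indices_in B \<omega>)) * (2 * cond_concordance h B - 1)\<bar>" for \<omega>
  define a where "a \<omega> = (\<Sum>(i, t)\<in>index_pairs. centered_kernel h B (\<omega> i) (\<omega> t))" for \<omega>
  define m where "m \<omega> = real (card (indices_in B \<omega>))" for \<omega>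
  have "card I \<ge> 1"
    using assms finite_I by (simp add: Suc_le_eq card_gt_0_iff)
  then have N: "N \<ge> 1" by (simp add: N_def)
  have q: "0 < q" "q \<le> 1"
    using prob_B by (auto simp: q_def)
  have "s > 0" "sqrt N \<ge> 1"
    using N q by (auto simp: s_def)
  have [measurable]: "a \<in> borel_measurable sample"
    unfolding a_def
    by (intro borel_measurable_sum) (auto intro: kernel_pair_measurable)
  have [measurable]: "m \<in> borel_measurable sample"
    unfolding m_def by measurable
  have m_bounds: "0 \<le> m \<omega>" "m \<omega> \<le> N" for \<omega>
    using card_indices_in_le[of B \<omega>] by (auto simp: m_def N_def)
  have abs_a: "\<bar>a \<omega>\<bar> \<le> real (card index_pairs)" for \<omega>
  proof -
    have "\<bar>a \<omega>\<bar> \<le> (\<Sum>p\<in>index_pairs. \<bar>case p of (i, t) \<Rightarrow> centered_kernel h B (\<omega> i) (\<omega> t)\<bar>)"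
      unfolding a_def by (rule sum_abs)
    also have "\<dots> \<le> (\<Sum>p\<in>index_pairs. 1)"
      by (intro sum_mono) (auto simp: abs_centered_kernel_le_1)
    finally show ?thesis by simp
  qed
  have int_a: "integrable sample (\<lambda>\<omega>. (a \<omega>)\<^sup>2)"
  proof (rule S.integrable_const_bound)
    show "AE \<omega> in sample. norm ((a \<omega>)\<^sup>2) \<le> (real (card index_pairs))\<^sup>2"
      using power_mono[OF abs_a abs_ge_zero, where n=2] by (intro AE_I2) simp
  qed measurable
  have abs_m: "\<bar>m \<omega> - N * q\<bar> \<le> N" for \<omega>
  proof -
    have "0 \<le> N * q" "N * q \<le> N"
      using q N by (simp_all add: mult_left_le)
    with m_bounds[of \<omega>] show ?thesis by linarith
  qed
  have int_m2: "integrable sample (\<lambda>\<omega>. (m \<omega> - N * q)\<^sup>2)"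
  proof (rule S.integrable_const_bound)
    show "AE \<omega> in sample. norm ((m \<omega> - N * q)\<^sup>2) \<le> N\<^sup>2"
      using power_mono[OF abs_m abs_ge_zero, where n=2] by (intro AE_I2) simp
  qed measurable
  have int_m: "integrable sample m"
    by (rule S.integrable_const_bound[where B=N]) (use m_bounds in auto)
  have int_x: "integrable sample x"
    using integrable_scaled_tau_deviation by (simp add: x_def[abs_def])
  have mean_m: "S.expectation m = N * q"
  proof -
    have "S.expectation m = (\<Sum>i\<in>I. S.expectation (\<lambda>\<omega>. indicat_real B (\<omega> i)))"
      unfolding m_def card_indices_in
      by (intro Bochner_Integration.integral_sum S.integrable_const_bound[where B=1]
          measurable_compose[OF coordinate_measurable]) (auto simp: indicator_def)
    also have "\<dots> = (\<Sum>i\<in>I. q)"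
      by (intro sum.cong) (auto simp: expectation_component q_def)
    finally show ?thesis by (simp add: N_def)
  qed
  have second_a: "S.expectation (\<lambda>\<omega>. (a \<omega>)\<^sup>2) \<le> s\<^sup>2"
  proof -
    have "s\<^sup>2 = 4 * N ^ 3 * q\<^sup>2"
      using N by (simp add: s_def power_mult_distrib power3_eq_cube power2_eq_square)
    then show ?thesis
      using second_moment_kernel_sum by (simp add: a_def N_def q_def)
  qed
  have second_m: "S.expectation (\<lambda>\<omega>. (m \<omega> - N * q)\<^sup>2) \<le> N * q"
    using second_moment_count[OF B] by (simp add: m_def card_indices_in N_def q_def)
  have "N * q * S.expectation x = S.expectation (\<lambda>\<omega>. N * q * x \<omega>)"
    by simp
  also have "\<dots> \<le> S.expectation (\<lambda>\<omega>. 2 * ((a \<omega>)\<^sup>2 / s + s)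
      + ((m \<omega> - N * q)\<^sup>2 / sqrt N + sqrt N) * (N * q) + 2 * (m \<omega> - N * q)\<^sup>2 + 2 * m \<omega>)"
  proof (rule integral_mono)
    fix \<omega>
    have "(m \<omega> - 1) * x \<omega> \<le> 4 * \<bar>a \<omega>\<bar>"
      unfolding m_def x_def a_def centered_kernel_sum
      by (rule scaled_tau_deviation_le) simp
    then show "N * q * x \<omega> \<le> 2 * ((a \<omega>)\<^sup>2 / s + s)
      + ((m \<omega> - N * q)\<^sup>2 / sqrt N + sqrt N) * (N * q) + 2 * (m \<omega> - N * q)\<^sup>2 + 2 * m \<omega>"
      by (rule deviation_quadratic_bound)
        (use abs_scaled_tau_deviation_le N q \<open>s > 0\<close> in \<open>auto simp: x_def m_def\<close>)
  qed (use int_a int_m int_m2 int_x in simp_all)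
  also have "\<dots> = 2 * (S.expectation (\<lambda>\<omega>. (a \<omega>)\<^sup>2) / s + s)
      + (S.expectation (\<lambda>\<omega>. (m \<omega> - N * q)\<^sup>2) / sqrt N + sqrt N) * (N * q)
      + 2 * S.expectation (\<lambda>\<omega>. (m \<omega> - N * q)\<^sup>2) + 2 * S.expectation m"
    using int_a int_m int_m2 by (simp add: S.P.prob_space)
  also have "\<dots> \<le> 2 * (s\<^sup>2 / s + s) + (N * q / sqrt N + sqrt N) * (N * q) + 2 * (N * q) + 2 * (N * q)"
    using second_a second_m N q \<open>s > 0\<close>
    by (intro add_mono mult_left_mono mult_right_mono divide_right_mono) (auto simp: mean_m)
  also have "\<dots> = N * q * (8 * sqrt N + q * sqrt N + sqrt N + 4)"
    using \<open>s > 0\<close> N by (simp add: power2_eq_square real_div_sqrt field_simps) (simp add: s_def algebra_simps)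
  \<comment> \<open>The pair sum gives 8, the class size deviation 1 + 1, and the two remaining
    terms 4, using \<open>q \<le> 1\<close> and \<open>1 \<le> sqrt N\<close>.\<close>
  also have "\<dots> \<le> N * q * (14 * sqrt N)"
  proof (intro mult_left_mono)
    have "q * sqrt N \<le> sqrt N"
      using N q by (intro mult_left_le_one_le) auto
    with \<open>sqrt N \<ge> 1\<close> show "8 * sqrt N + q * sqrt N + sqrt N + 4 \<le> 14 * sqrt N"
      by linarith
  qed (use N q in auto)
  finally show ?thesis
    using N q by (simp add: x_def[abs_def] N_def)
qed

end

end

section \<open>Concentration of the empirical score\<close>

lemma abs_two_mult_minus_one_le:
  fixes u :: real
  assumes "0 \<le> u" "u \<le> 1"
  shows "\<bar>2 * u - 1\<bar> \<le> 1"
  using assms by linarith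

locale obs_sample = prob_space D for D :: "obs measure" +
  fixes n :: nat
  assumes sets_D: "sets D = sets (borel \<Otimes>\<^sub>M count_space UNIV)"
    and n_pos: "n \<ge> 1"

sublocale obs_sample \<subseteq> iid_sample D "{1..n}"
  by unfold_locales simp

section \<open>Transfer to labelled observations\<close>

context obs_sample
begin

definition class_set :: "nat \<Rightarrow> obs set" where
  "class_set k = {z \<in> space D. snd z = k}"

lemma space_D [simp]: "space D = UNIV"
  using sets_eq_imp_space_eq[OF sets_D] by (simp add: space_pair_measure)

lemma feature_measurable [measurable]: "(\<lambda>z. fst z j) \<in> borel_measurable D"
proof -
  have "fst \<in> measurable (borel \<Otimes>\<^sub>M count_space UNIV) (borel :: (nat \<Rightarrow> real) measure)"
    by (rule measurable_fst)
  then have "fst \<in> measurable D borel"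
    using measurable_cong_sets[OF sets_D refl] by blast
  moreover have "(\<lambda>x. x j) \<in> borel_measurable (borel :: (nat \<Rightarrow> real) measure)"
    by (intro borel_measurable_continuous_onI continuous_on_product_coordinates)
  ultimately show ?thesis
    by (rule measurable_compose)
qed

lemma label_measurable [measurable]: "snd \<in> measurable D (count_space UNIV)"
  using measurable_cong_sets[OF sets_D refl] measurable_snd by blast

lemma concordant_measurable [measurable]:
  "Measurable.pred (D \<Otimes>\<^sub>M D) (\<lambda>(a, b). concordant j l a b)"
  unfolding concordant_def case_prod_unfold by measurable

lemma class_set_measurable [measurable]: "class_set k \<in> sets D"
  unfolding class_set_def by measurable

lemma class_prob_eq: "class_prob D k = prob (class_set k)"
  by (simp add: class_prob_def class_set_def)

lemma class_indices_eq: "class_indices n \<omega> k = indices_in (class_set k) \<omega>"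
  unfolding class_indices_def indices_in_def class_set_def by auto

lemma all_indices_eq: "indices_in (space D) \<omega> = {1..n}"
  unfolding indices_in_def by auto

lemma cond_kendall_tau_eq:
  assumes "prob (class_set k) > 0"
  shows "cond_kendall_tau D k j l = 2 * cond_concordance (concordant j l) (class_set k) - 1"
proof -
  have "{(a, b) \<in> space (D \<Otimes>\<^sub>M D). snd a = k \<and> snd b = k} = class_set k \<times> class_set k"
    by (auto simp: class_set_def space_pair_measure)
  moreover have "{(a, b) \<in> space (D \<Otimes>\<^sub>M D). concordant j l a b \<and> snd a = k \<and> snd b = k}
      = {(a, b) \<in> space (D \<Otimes>\<^sub>M D). concordant j l a b \<and> a \<in> class_set k \<and> b \<in> class_set k}"
    by (auto simp: class_set_def space_pair_measure)
  ultimately show ?thesis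
    using assms measure_square[OF class_set_measurable]
    by (simp add: cond_kendall_tau_def cond_concordance_def)
qed

lemma prob_space_D_pos: "prob (space D) > 0"
  using prob_space by simp

lemma kendall_tau_eq: "kendall_tau D j l = 2 * cond_concordance (concordant j l) (space D) - 1"
  using prob_space by (simp add: kendall_tau_def cond_concordance_def)

lemma scaled_tau_all_measurable [measurable]:
  "(\<lambda>\<omega>. scaled_tau {1..n} (sample_concordant j l \<omega>)) \<in> borel_measurable sample"
  using scaled_tau_measurable[OF concordant_measurable sets.top prob_space_D_pos]
  unfolding all_indices_eq .

lemma emp_kendall_tau_measurable [measurable]:
  "(\<lambda>\<omega>. emp_kendall_tau n \<omega> j l) \<in> borel_measurable sample"
proof -
  have "emp_kendall_tau n \<omega> j l = scaled_tau {1..n} (sample_concordant j l \<omega>) / real n" for \<omega>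
    using scaled_tau_all[OF n_pos, of \<omega> j l] n_pos by (simp add: field_simps)
  moreover have "(\<lambda>\<omega>. scaled_tau {1..n} (sample_concordant j l \<omega>) / real n) \<in> borel_measurable sample"
    by measurable
  ultimately show ?thesis by (simp only:)
qed

lemma emp_KIF_score_measurable:
  assumes "\<And>k. k \<in> {1..K} \<Longrightarrow> class_prob D k > 0"
  shows "(\<lambda>\<omega>. emp_KIF_score n \<omega> K j l) \<in> borel_measurable sample"
proof -
  have "emp_KIF_score n \<omega> K j l = (\<Sum>k=1..K. \<bar>scaled_tau (class_indices n \<omega> k) (sample_concordant j l \<omega>)
          - real (class_count n \<omega> k) * emp_kendall_tau n \<omega> j l\<bar>) / real n" for \<omega>
    using emp_KIF_score_eq[of n \<omega> K j l] n_pos by (simp add: field_simps)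
  moreover have "(\<lambda>\<omega>. \<Sum>k=1..K. \<bar>scaled_tau (class_indices n \<omega> k) (sample_concordant j l \<omega>)
          - real (class_count n \<omega> k) * emp_kendall_tau n \<omega> j l\<bar>) \<in> borel_measurable sample"
  proof (rule borel_measurable_sum)
    fix k assume "k \<in> {1..K}"
    then have pos: "prob (class_set k) > 0"
      using assms class_prob_eq by simp
    show "(\<lambda>\<omega>. \<bar>scaled_tau (class_indices n \<omega> k) (sample_concordant j l \<omega>)
          - real (class_count n \<omega> k) * emp_kendall_tau n \<omega> j l\<bar>) \<in> borel_measurable sample"
      unfolding class_count_eq class_indices_eq
      by (intro borel_measurable_abs borel_measurable_diff borel_measurable_times emp_kendall_tau_measurable
          scaled_tau_measurable[OF concordant_measurable class_set_measurable pos]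
          card_indices_in_measurable[OF class_set_measurable])
  qed
  ultimately show ?thesis
    by (simp only: borel_measurable_divide borel_measurable_const)
qed

lemma integrable_emp_KIF_score:
  assumes "\<And>k. k \<in> {1..K} \<Longrightarrow> class_prob D k > 0"
  shows "integrable sample (\<lambda>\<omega>. emp_KIF_score n \<omega> K j l)"
  using emp_KIF_score_bounds
  by (intro S.integrable_const_bound[where B=2] emp_KIF_score_measurable assms AE_I2) auto

text \<open>A pointwise decomposition. Inside each absolute value the empirical tau is first
  replaced by the true one with the random weight \<open>m k\<close> kept, and then the weight by
  its mean. Since the true taus are at most 1 in absolute value, the second replacement costs
  \<open>\<bar>m k - \<mu> k\<bar>\<close>, once for the class tau and once for the overall tau. The
  error of the overall tau has weights summing to at most \<open>n\<close>, so it appears once and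
  not once per class.\<close>

lemma KIF_score_error_le:
  assumes pos: "\<And>k. k \<in> {1..K} \<Longrightarrow> class_prob D k > 0"
  shows "real n * \<bar>emp_KIF_score n \<omega> K j l - KIF_score D K j l\<bar>
    \<le> (\<Sum>k=1..K. \<bar>scaled_tau (class_indices n \<omega> k) (sample_concordant j l \<omega>)
             - real (class_count n \<omega> k) * cond_kendall_tau D k j l\<bar>
           + 2 * \<bar>real (class_count n \<omega> k) - real n * class_prob D k\<bar>)
      + \<bar>scaled_tau {1..n} (sample_concordant j l \<omega>) - real n * kendall_tau D j l\<bar>"
proof -
  let ?s = "\<lambda>k. scaled_tau (class_indices n \<omega> k) (sample_concordant j l \<omega>)"
  let ?m = "\<lambda>k. real (class_count n \<omega> k)" and ?\<mu> = "\<lambda>k. real n * class_prob D k"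
  let ?t = "emp_kendall_tau n \<omega> j l" and ?\<tau> = "kendall_tau D j l"
  let ?\<tau>k = "\<lambda>k. cond_kendall_tau D k j l"
  have tau_k: "\<bar>?\<tau>k k\<bar> \<le> 1" if "k \<in> {1..K}" for k
  proof -
    have "prob (class_set k) > 0" using pos[OF that] by (simp add: class_prob_eq)
    then show ?thesis
      unfolding cond_kendall_tau_eq[OF \<open>prob (class_set k) > 0\<close>]
      by (intro abs_two_mult_minus_one_le cond_concordance_bounds) auto
  qed
  have tau: "\<bar>?\<tau>\<bar> \<le> 1"
    unfolding kendall_tau_eq
    by (intro abs_two_mult_minus_one_le cond_concordance_bounds[OF concordant_measurable sets.top prob_space_D_pos])
  have KIF: "real n * KIF_score D K j l = (\<Sum>k=1..K. \<bar>?\<mu> k * ?\<tau>k k - ?\<mu> k * ?\<tau>\<bar>)"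
    unfolding KIF_score_def sum_distrib_left
    by (intro sum.cong) (auto simp: abs_mult class_prob_eq right_diff_distrib[symmetric])
  have "real n * \<bar>emp_KIF_score n \<omega> K j l - KIF_score D K j l\<bar>
      = \<bar>real n * emp_KIF_score n \<omega> K j l - real n * KIF_score D K j l\<bar>"
    by (simp add: abs_mult right_diff_distrib[symmetric])
  also have "\<dots> \<le> (\<Sum>k=1..K. \<bar>\<bar>?s k - ?m k * ?t\<bar> - \<bar>?\<mu> k * ?\<tau>k k - ?\<mu> k * ?\<tau>\<bar>\<bar>)"
    unfolding emp_KIF_score_eq KIF sum_subtractf[symmetric] by (rule sum_abs)
  also have "\<dots> \<le> (\<Sum>k=1..K. (\<bar>?s k - ?m k * ?\<tau>k k\<bar> + 2 * \<bar>?m k - ?\<mu> k\<bar>) + ?m k * \<bar>?t - ?\<tau>\<bar>)"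
  proof (rule sum_mono)
    fix k assume k: "k \<in> {1..K}"
    have "?s k - ?\<mu> k * ?\<tau>k k = (?s k - ?m k * ?\<tau>k k) + (?m k - ?\<mu> k) * ?\<tau>k k"
      by (simp add: algebra_simps)
    also have "\<bar>\<dots>\<bar> \<le> \<bar>?s k - ?m k * ?\<tau>k k\<bar> + \<bar>?m k - ?\<mu> k\<bar>"
      using tau_k[OF k] by (intro order.trans[OF abs_triangle_ineq] add_mono) (simp_all add: abs_mult mult_left_le)
    finally have 1: "\<bar>?s k - ?\<mu> k * ?\<tau>k k\<bar> \<le> \<bar>?s k - ?m k * ?\<tau>k k\<bar> + \<bar>?m k - ?\<mu> k\<bar>" .
    have "?m k * ?t - ?\<mu> k * ?\<tau> = ?m k * (?t - ?\<tau>) + (?m k - ?\<mu> k) * ?\<tau>"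
      by (simp add: algebra_simps)
    also have "\<bar>\<dots>\<bar> \<le> ?m k * \<bar>?t - ?\<tau>\<bar> + \<bar>?m k - ?\<mu> k\<bar>"
      using tau by (intro order.trans[OF abs_triangle_ineq] add_mono) (simp_all add: abs_mult mult_left_le)
    finally have 2: "\<bar>?m k * ?t - ?\<mu> k * ?\<tau>\<bar> \<le> ?m k * \<bar>?t - ?\<tau>\<bar> + \<bar>?m k - ?\<mu> k\<bar>" .
    show "\<bar>\<bar>?s k - ?m k * ?t\<bar> - \<bar>?\<mu> k * ?\<tau>k k - ?\<mu> k * ?\<tau>\<bar>\<bar>
        \<le> (\<bar>?s k - ?m k * ?\<tau>k k\<bar> + 2 * \<bar>?m k - ?\<mu> k\<bar>) + ?m k * \<bar>?t - ?\<tau>\<bar>"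
      using abs_diff_abs_diff_le[OF 1 2] by simp
  qed
  also have "\<dots> = (\<Sum>k=1..K. \<bar>?s k - ?m k * ?\<tau>k k\<bar> + 2 * \<bar>?m k - ?\<mu> k\<bar>) + (\<Sum>k=1..K. ?m k) * \<bar>?t - ?\<tau>\<bar>"
    by (simp only: sum.distrib sum_distrib_right)
  also have "\<dots> \<le> (\<Sum>k=1..K. \<bar>?s k - ?m k * ?\<tau>k k\<bar> + 2 * \<bar>?m k - ?\<mu> k\<bar>) + real n * \<bar>?t - ?\<tau>\<bar>"
    by (intro add_left_mono mult_right_mono sum_class_count_le) simp
  also have "real n * \<bar>?t - ?\<tau>\<bar> = \<bar>real n * ?t - real n * ?\<tau>\<bar>"
    by (simp add: abs_mult right_diff_distrib[symmetric])
  finally show ?thesis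
    unfolding scaled_tau_all[OF n_pos] .
qed

lemma expectation_KIF_score_error_le:
  assumes pos: "\<And>k. k \<in> {1..K} \<Longrightarrow> class_prob D k > 0" and "K \<ge> 1"
  shows "S.expectation (\<lambda>\<omega>. \<bar>emp_KIF_score n \<omega> K j l - KIF_score D K j l\<bar>) \<le> 30 * real K / sqrt (real n)"
proof -
  define x where "x k \<omega> = \<bar>scaled_tau (class_indices n \<omega> k) (sample_concordant j l \<omega>)
             - real (class_count n \<omega> k) * cond_kendall_tau D k j l\<bar>" for k \<omega>
  define y where "y k \<omega> = \<bar>real (class_count n \<omega> k) - real n * class_prob D k\<bar>" for k \<omega>
  define x0 where "x0 \<omega> = \<bar>scaled_tau {1..n} (sample_concordant j l \<omega>) - real n * kendall_tau D j l\<bar>" for \<omega>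
  have ne: "{1..n} \<noteq> {}" and card: "card {1..n} = n"
    using n_pos by auto
  have x: "integrable sample (x k)" "S.expectation (x k) \<le> 14 * sqrt (real n)"
    and y: "integrable sample (y k)" "S.expectation (y k) \<le> sqrt (real n)" if "k \<in> {1..K}" for k
  proof -
    have pos_k: "prob (class_set k) > 0" using pos[OF that] by (simp add: class_prob_eq)
    note c = concordant_measurable[of j l] class_set_measurable[of k] pos_k
    show "integrable sample (x k)" "S.expectation (x k) \<le> 14 * sqrt (real n)"
      using integrable_scaled_tau_deviation[OF c] expectation_scaled_tau_deviation_le[OF c ne]
      unfolding x_def[abs_def] cond_kendall_tau_eq[OF pos_k] class_count_eq class_indices_eq card
      by auto
    show "integrable sample (y k)" "S.expectation (y k) \<le> sqrt (real n)"
      using integrable_count_deviation[OF c(2)] expectation_count_deviation_le[OF c(2) ne]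
      unfolding y_def[abs_def] class_prob_eq class_count_eq class_indices_eq card
      by auto
  qed
  note c0 = concordant_measurable[of j l] sets.top prob_space_D_pos
  have x0: "integrable sample x0" "S.expectation x0 \<le> 14 * sqrt (real n)"
    using integrable_scaled_tau_deviation[OF c0] expectation_scaled_tau_deviation_le[OF c0 ne]
    unfolding x0_def[abs_def] kendall_tau_eq all_indices_eq card by auto
  have int: "integrable sample (\<lambda>\<omega>. \<bar>emp_KIF_score n \<omega> K j l - KIF_score D K j l\<bar>)"
    by (intro integrable_abs Bochner_Integration.integrable_diff integrable_emp_KIF_score[OF pos] S.integrable_const)
  have "real n * S.expectation (\<lambda>\<omega>. \<bar>emp_KIF_score n \<omega> K j l - KIF_score D K j l\<bar>)
      = S.expectation (\<lambda>\<omega>. real n * \<bar>emp_KIF_score n \<omega> K j l - KIF_score D K j l\<bar>)"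
    by simp
  also have "\<dots> \<le> S.expectation (\<lambda>\<omega>. (\<Sum>k=1..K. x k \<omega> + 2 * y k \<omega>) + x0 \<omega>)"
  proof (rule integral_mono)
    show "real n * \<bar>emp_KIF_score n \<omega> K j l - KIF_score D K j l\<bar> \<le> (\<Sum>k=1..K. x k \<omega> + 2 * y k \<omega>) + x0 \<omega>" for \<omega>
      unfolding x_def y_def x0_def by (rule KIF_score_error_le[OF pos])
    show "integrable sample (\<lambda>\<omega>. (\<Sum>k=1..K. x k \<omega> + 2 * y k \<omega>) + x0 \<omega>)"
      by (intro Bochner_Integration.integrable_add Bochner_Integration.integrable_sum
          integrable_mult_right x y x0)
  qed (use int in simp)
  also have "\<dots> = (\<Sum>k=1..K. S.expectation (x k) + 2 * S.expectation (y k)) + S.expectation x0"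
  proof -
    have xy: "integrable sample (\<lambda>\<omega>. x k \<omega> + 2 * y k \<omega>)"
      "S.expectation (\<lambda>\<omega>. x k \<omega> + 2 * y k \<omega>) = S.expectation (x k) + 2 * S.expectation (y k)"
      if "k \<in> {1..K}" for k
      using x(1)[OF that] y(1)[OF that] by simp_all
    have "S.expectation (\<lambda>\<omega>. (\<Sum>k=1..K. x k \<omega> + 2 * y k \<omega>) + x0 \<omega>)
        = S.expectation (\<lambda>\<omega>. \<Sum>k=1..K. x k \<omega> + 2 * y k \<omega>) + S.expectation x0"
      by (intro Bochner_Integration.integral_add Bochner_Integration.integrable_sum xy x0)
    also have "S.expectation (\<lambda>\<omega>. \<Sum>k=1..K. x k \<omega> + 2 * y k \<omega>)
        = (\<Sum>k=1..K. S.expectation (\<lambda>\<omega>. x k \<omega> + 2 * y k \<omega>))"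
      by (intro Bochner_Integration.integral_sum xy)
    also have "\<dots> = (\<Sum>k=1..K. S.expectation (x k) + 2 * S.expectation (y k))"
      by (intro sum.cong xy refl)
    finally show ?thesis .
  qed
  also have "\<dots> \<le> (\<Sum>k=1..K. 14 * sqrt (real n) + 2 * sqrt (real n)) + 14 * sqrt (real n)"
    by (intro add_mono sum_mono mult_left_mono x y x0) auto
  \<comment> \<open>Each class contributes 14 + 2 = 16, and \<open>K \<ge> 1\<close> absorbs the
    single 14 of the overall tau into \<open>30 * K\<close>.\<close>
  also have "\<dots> \<le> 30 * real K * sqrt (real n)"
    using mult_right_mono[of 1 "real K" "14 * sqrt (real n)"] \<open>K \<ge> 1\<close> by simp
  finally have "real n * S.expectation (\<lambda>\<omega>. \<bar>emp_KIF_score n \<omega> K j l - KIF_score D K j l\<bar>)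
      \<le> 30 * real K * sqrt (real n)" .
  then have "S.expectation (\<lambda>\<omega>. \<bar>emp_KIF_score n \<omega> K j l - KIF_score D K j l\<bar>)
      \<le> 30 * real K * (sqrt (real n) / real n)"
    using n_pos by (simp add: field_simps)
  then show ?thesis
    unfolding sqrt_divide_self_eq[OF of_nat_0_le_iff] by (simp only: divide_inverse)
qed

text \<open>The tolerance \<open>e\<close> is shared equally: the bias, at most
  \<open>30 * K / sqrt n\<close>, takes one half and McDiarmid's inequality the other. Its exponent
  \<open>2 * (e/2)^2 / (n * (14/n)^2)\<close> is \<open>n * e^2 / 392\<close>.\<close>

lemma KIF_score_deviation_prob_le:
  assumes pos: "\<And>k. k \<in> {1..K} \<Longrightarrow> class_prob D k > 0" and "K \<ge> 1"
    and e: "e > 0" "60 * real K / sqrt (real n) \<le> e"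
  shows "S.prob {\<omega> \<in> space sample. \<bar>emp_KIF_score n \<omega> K j l - KIF_score D K j l\<bar> > e}
    \<le> 2 * exp (- (real n * e\<^sup>2) / 392)"
proof -
  let ?w = "\<lambda>\<omega>. emp_KIF_score n \<omega> K j l"
  have int_w: "integrable sample ?w"
    by (rule integrable_emp_KIF_score[OF pos])
  have "\<bar>S.expectation ?w - KIF_score D K j l\<bar> = \<bar>S.expectation (\<lambda>\<omega>. ?w \<omega> - KIF_score D K j l)\<bar>"
    by (subst Bochner_Integration.integral_diff[OF int_w S.integrable_const])
      (simp add: S.P.prob_space del: One_nat_def)
  also have "\<dots> \<le> S.expectation (\<lambda>\<omega>. \<bar>?w \<omega> - KIF_score D K j l\<bar>)"
    by (rule integral_abs_bound)
  also have "\<dots> \<le> e / 2"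
    using expectation_KIF_score_error_le[OF pos \<open>K \<ge> 1\<close>, of j l] e by simp
  finally have bias: "\<bar>S.expectation ?w - KIF_score D K j l\<bar> \<le> e / 2" .
  have "S.prob {\<omega> \<in> space sample. \<bar>?w \<omega> - KIF_score D K j l\<bar> > e}
      \<le> S.prob {\<omega> \<in> space sample. \<bar>?w \<omega> - S.expectation ?w\<bar> \<ge> e / 2}"
  proof (rule S.finite_measure_mono)
    have "e / 2 \<le> \<bar>?w \<omega> - S.expectation ?w\<bar>" if "\<bar>?w \<omega> - KIF_score D K j l\<bar> > e" for \<omega>
      using that bias by linarith
    then show "{\<omega> \<in> space sample. \<bar>?w \<omega> - KIF_score D K j l\<bar> > e}
        \<subseteq> {\<omega> \<in> space sample. \<bar>?w \<omega> - S.expectation ?w\<bar> \<ge> e / 2}"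
      by auto
    show "{\<omega> \<in> space sample. \<bar>?w \<omega> - S.expectation ?w\<bar> \<ge> e / 2} \<in> S.events"
      using borel_measurable_integrable[OF int_w] by measurable
  qed
  also have "\<dots> \<le> 2 * exp (- 2 * (e / 2)\<^sup>2 / (\<Sum>i\<in>{1..n}. (14 / real n)\<^sup>2))"
    using e n_pos emp_KIF_score_bounds emp_KIF_score_bounded_diff
    by (intro S.McDiarmid_ineq_abs_ge[where B=2] emp_KIF_score_measurable pos) auto
  also have "- 2 * (e / 2)\<^sup>2 / (\<Sum>i\<in>{1..n}. (14 / real n)\<^sup>2) = - (real n * e\<^sup>2) / 392"
    using n_pos by (simp add: field_simps power2_eq_square)
  finally show ?thesis .
qed

text \<open>The union bound runs over couples only. Leaving the set \<open>T\<close> free serves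
  both claims: all couples give the factor p^2, the relevant ones the factor s.\<close>

lemma KIF_score_uniform_deviation:
  assumes pos: "\<And>k. k \<in> {1..K} \<Longrightarrow> class_prob D k > 0" and "K \<ge> 1"
    and e: "e > 0" "60 * real K / sqrt (real n) \<le> e" and "finite T"
  defines "G \<equiv> {\<omega> \<in> space sample. \<forall>(j, l)\<in>T. \<bar>emp_KIF_score n \<omega> K j l - KIF_score D K j l\<bar> \<le> e}"
  shows "G \<in> S.events" "1 - S.prob G \<le> real (card T) * (2 * exp (- (real n * e\<^sup>2) / 392))"
proof -
  let ?E = "\<lambda>(j, l). {\<omega> \<in> space sample. \<bar>emp_KIF_score n \<omega> K j l - KIF_score D K j l\<bar> > e}"
  have E: "?E p \<in> S.events" for p
    using emp_KIF_score_measurable[OF pos, of K "fst p" "snd p"] by (simp add: case_prod_unfold)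
  have G: "G = space sample - (\<Union>p\<in>T. ?E p)"
    by (auto simp: G_def not_less split: prod.splits)
  then show "G \<in> S.events"
    using E \<open>finite T\<close> by auto
  have "1 - S.prob G = S.prob (\<Union>p\<in>T. ?E p)"
    unfolding G using E \<open>finite T\<close> by (subst S.P.prob_compl) auto
  also have "\<dots> \<le> (\<Sum>p\<in>T. S.prob (?E p))"
    using E \<open>finite T\<close> by (intro S.finite_measure_subadditive_finite) auto
  also have "\<dots> \<le> (\<Sum>p\<in>T. 2 * exp (- (real n * e\<^sup>2) / 392))"
    using KIF_score_deviation_prob_le[OF pos \<open>K \<ge> 1\<close> e] by (intro sum_mono) (auto simp: case_prod_unfold)
  finally show "1 - S.prob G \<le> real (card T) * (2 * exp (- (real n * e\<^sup>2) / 392))"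
    by simp
qed

end

section \<open>Comparison of rates and conclusion\<close>

lemma eventually_bias_le:
  fixes K :: "nat \<Rightarrow> nat" and c r d :: real
  assumes "c > 0" "d < 1/2 - r" and K: "(\<lambda>n. real (K n)) \<in> O(\<lambda>n. real n powr d)"
  shows "\<forall>\<^sub>F n in sequentially. 60 * real (K n) / sqrt (real n) \<le> c * real n powr (- r)"
proof -
  from K obtain C where C: "C > 0" "\<forall>\<^sub>F n in sequentially. norm (real (K n)) \<le> C * norm (real n powr d)"
    by (elim landau_o.bigE)
  \<comment> \<open>The bias relative to \<open>n powr (-r)\<close> is of order
    \<open>n powr (d - 1/2 + r)\<close>, and the bound on \<open>d\<close> in (C3) makes this
    exponent negative.\<close>
  have "((\<lambda>n. (60 * C) * real n powr (d - 1/2 + r)) \<longlongrightarrow> (60 * C) * 0) sequentially"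
    using assms(2)
    by (intro tendsto_mult tendsto_const tendsto_neg_powr filterlim_real_sequentially) auto
  then have "\<forall>\<^sub>F n in sequentially. 60 * C * real n powr (d - 1/2 + r) < c"
    using \<open>c > 0\<close> by (intro order_tendstoD(2)) auto
  with C(2) eventually_gt_at_top[of 0] show ?thesis
  proof eventually_elim
    case (elim n)
    have "60 * real (K n) / sqrt (real n) \<le> 60 * (C * real n powr d) / sqrt (real n)"
      using elim by (intro divide_right_mono mult_left_mono) auto
    also have "\<dots> = 60 * C * real n powr (d - 1/2 + r) * real n powr (- r)"
    proof -
      have "real n powr (d - 1/2 + r) * real n powr (- r) = real n powr d / real n powr (1/2)"
        by (simp flip: powr_add powr_diff)
      then show ?thesis
        by (simp add: powr_half_sqrt mult.assoc)
    qed
    also have "\<dots> \<le> c * real n powr (- r)"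
      using elim by (intro mult_right_mono) auto
    finally show ?case .
  qed
qed

text \<open>Here \<open>b = 3\<close> is fixed: \<open>72 * 3^2 = 648\<close> is at least 392, while
  \<open>72 * 2^2 = 288\<close> is not. Lowering the power of \<open>n\<close> from
  \<open>1 - 2 * r\<close> to \<open>1 - 2 * (r + d)\<close> and inserting the factor
  \<open>n powr d\<close> only enlarge the right-hand side, since \<open>n \<ge> 1\<close>.\<close>

lemma tail_exponent_le:
  fixes c r d :: real and n :: nat
  assumes "n \<ge> 1" "d \<ge> 0"
  shows "exp (- (real n * (c * real n powr (- r))\<^sup>2) / 392)
    \<le> real n powr d * exp (- (c\<^sup>2 * real n powr (1 - 2 * (r + d))) / (72 * 3\<^sup>2))"
proof -
  have "real n * (c * real n powr (- r))\<^sup>2 = c\<^sup>2 * real n powr (1 - 2 * r)"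
    using \<open>n \<ge> 1\<close> by (simp add: power_mult_distrib powr_diff powr_minus powr_power divide_inverse mult_ac power_inverse)
  moreover have "c\<^sup>2 * real n powr (1 - 2 * (r + d)) / (72 * 3\<^sup>2) \<le> c\<^sup>2 * real n powr (1 - 2 * r) / 392"
    using assms by (intro frac_le mult_left_mono powr_mono) auto
  ultimately have "exp (- (real n * (c * real n powr (- r))\<^sup>2) / 392)
      \<le> 1 * exp (- (c\<^sup>2 * real n powr (1 - 2 * (r + d))) / (72 * 3\<^sup>2))"
    by simp
  also have "\<dots> \<le> real n powr d * exp (- (c\<^sup>2 * real n powr (1 - 2 * (r + d))) / (72 * 3\<^sup>2))"
    using assms by (intro mult_right_mono ge_one_powr_ge_zero) auto
  finally show ?thesis .
qed

theorem theorem1: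
  fixes c c1 c2 :: real
  assumes "c > 0" and "c1 > 0" and "c2 > 0"
  shows "\<exists>b>0. \<forall>(D :: nat \<Rightarrow> obs measure) (p :: nat \<Rightarrow> nat) (K :: nat \<Rightarrow> nat)
              (S :: nat \<Rightarrow> (nat \<times> nat) set) (r :: real) (d :: real).
     ( (\<forall>n. prob_space (D n))
     \<and> (\<forall>n. sets (D n) = sets (borel \<Otimes>\<^sub>M count_space UNIV))
     \<and> (\<forall>n. p n \<ge> 1 \<and> K n \<ge> 1)
     \<and> (\<forall>n. AE z in D n. snd z \<in> {1..K n})
     \<and> (\<forall>n. S n \<subseteq> {1..p n} \<times> {1..p n})
     \<comment> \<open>(C1)\<close>
     \<and> (\<forall>n. \<forall>k\<in>{1..K n}. c1 / real (K n) \<le> class_prob (D n) k \<and> class_prob (D n) k \<le> c2 / real (K n))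
     \<comment> \<open>(C2)\<close>
     \<and> 0 \<le> r \<and> r < 1/2
     \<and> (\<forall>n. \<forall>(j, l)\<in>S n. KIF_score (D n) (K n) j l > 2 * c * real n powr (-r))
     \<comment> \<open>(C3)\<close>
     \<and> 0 \<le> d \<and> d < 1/2 - r
     \<and> (\<lambda>n. real (K n)) \<in> O(\<lambda>n. real n powr d)
     \<comment> \<open>(C4)\<close>
     \<and> (\<lambda>n. ln (real (p n))) \<in> o(\<lambda>n. real n powr (1 - 2 * (r + d))) )
     \<longrightarrow>
       (\<lambda>n. 1 - measure (sample_law n (D n))
                {\<omega> \<in> space (sample_law n (D n)).
                   Max ((\<lambda>(j, l). \<bar>emp_KIF_score n \<omega> (K n) j l - KIF_score (D n) (K n) j l\<bar>)
                          ` ({1..p n} \<times> {1..p n})) \<le> c * real n powr (-r)})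
         \<in> O(\<lambda>n. real (p n) ^ 2 * real n powr d
                  * exp (- (c^2 * real n powr (1 - 2 * (r + d))) / (72 * b^2)))
     \<and> (\<lambda>n. 1 - measure (sample_law n (D n))
                {\<omega> \<in> space (sample_law n (D n)).
                   S n \<subseteq> {(j, l) \<in> {1..p n} \<times> {1..p n}. emp_KIF_score n \<omega> (K n) j l > c * real n powr (-r)}})
         \<in> O(\<lambda>n. real (card (S n)) * real n powr d
                  * exp (- (c^2 * real n powr (1 - 2 * (r + d))) / (72 * b^2)))"
proof (intro exI[of _ 3] conjI allI impI; (elim conjE)?)
  show "(3::real) > 0" by simp
next
  fix D :: "nat \<Rightarrow> obs measure" and p K :: "nat \<Rightarrow> nat" and S :: "nat \<Rightarrow> (nat \<times> nat) set" and r d :: real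
  assume prob: "\<forall>n. prob_space (D n)"
    and sets: "\<forall>n. sets (D n) = sets (borel \<Otimes>\<^sub>M count_space UNIV)"
    and pK: "\<forall>n. p n \<ge> 1 \<and> K n \<ge> 1"
    and C1: "\<forall>n. \<forall>k\<in>{1..K n}. c1 / real (K n) \<le> class_prob (D n) k \<and> class_prob (D n) k \<le> c2 / real (K n)"
    and d: "0 \<le> d" "d < 1/2 - r"
    and K: "(\<lambda>n. real (K n)) \<in> O(\<lambda>n. real n powr d)"
  \<comment> \<open>In spite of its name this is the favourable event, whose complement has to be
    rare.\<close>
  let ?bad = "\<lambda>n. {\<omega> \<in> space (sample_law n (D n)).
                   Max ((\<lambda>(j, l). \<bar>emp_KIF_score n \<omega> (K n) j l - KIF_score (D n) (K n) j l\<bar>)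
                          ` ({1..p n} \<times> {1..p n})) \<le> c * real n powr (-r)}"
  show "(\<lambda>n. 1 - measure (sample_law n (D n)) (?bad n))
         \<in> O(\<lambda>n. real (p n) ^ 2 * real n powr d
                  * exp (- (c^2 * real n powr (1 - 2 * (r + d))) / (72 * 3^2)))"
  proof (rule bigoI[where c=2])
    show "\<forall>\<^sub>F n in sequentially. norm (1 - measure (sample_law n (D n)) (?bad n))
        \<le> 2 * norm (real (p n) ^ 2 * real n powr d
                  * exp (- (c^2 * real n powr (1 - 2 * (r + d))) / (72 * 3^2)))"
      using eventually_bias_le[OF \<open>c > 0\<close> d(2) K] eventually_ge_at_top[of 1]
    proof eventually_elim
      case (elim n)
      interpret obs_sample "D n" n
        using prob sets elim by (intro obs_sample.intro obs_sample_axioms.intro) auto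
      let ?e = "c * real n powr (-r)" and ?T = "{1..p n} \<times> {1..p n}"
      let ?G = "{\<omega> \<in> space sample. \<forall>(j, l)\<in>?T. \<bar>emp_KIF_score n \<omega> (K n) j l - KIF_score (D n) (K n) j l\<bar> \<le> ?e}"
      have pos: "class_prob (D n) k > 0" if "k \<in> {1..K n}" for k
        using C1 that pK \<open>c1 > 0\<close> by (meson divide_pos_pos less_le_trans of_nat_0_less_iff zero_less_one)
      \<comment> \<open>Nonemptiness is what makes a bound on \<open>Max\<close> equivalent to a
        bound on every element.\<close>
      have "?T \<noteq> {}" using pK by auto
      then have "?bad n = ?G"
        unfolding sample_law_def by (subst Max_le_iff) auto
      then have "1 - measure (sample_law n (D n)) (?bad n) \<le> real (card ?T) * (2 * exp (- (real n * ?e\<^sup>2) / 392))"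
        unfolding sample_law_def using pK elim \<open>c > 0\<close>
        by (simp only:) (intro KIF_score_uniform_deviation(2) pos; simp)
      also have "\<dots> \<le> real (card ?T) * (2 * (real n powr d * exp (- (c\<^sup>2 * real n powr (1 - 2 * (r + d))) / (72 * 3\<^sup>2))))"
        using elim d by (intro mult_left_mono tail_exponent_le) auto
      finally have "1 - measure (sample_law n (D n)) (?bad n)
          \<le> 2 * (real (p n) ^ 2 * real n powr d * exp (- (c^2 * real n powr (1 - 2 * (r + d))) / (72 * 3^2)))"
        by (simp add: power2_eq_square mult_ac)
      moreover have "measure (sample_law n (D n)) (?bad n) \<le> 1"
        unfolding sample_law_def by (rule S.P.prob_le_1)
      ultimately show ?case
        by simp
    qed
  qed
next
  fix D :: "nat \<Rightarrow> obs measure" and p K :: "nat \<Rightarrow> nat" and S :: "nat \<Rightarrow> (nat \<times> nat) set" and r d :: real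
  assume prob: "\<forall>n. prob_space (D n)"
    and sets: "\<forall>n. sets (D n) = sets (borel \<Otimes>\<^sub>M count_space UNIV)"
    and pK: "\<forall>n. p n \<ge> 1 \<and> K n \<ge> 1"
    and S_sub: "\<forall>n. S n \<subseteq> {1..p n} \<times> {1..p n}"
    and C1: "\<forall>n. \<forall>k\<in>{1..K n}. c1 / real (K n) \<le> class_prob (D n) k \<and> class_prob (D n) k \<le> c2 / real (K n)"
    and C2: "\<forall>n. \<forall>(j, l)\<in>S n. KIF_score (D n) (K n) j l > 2 * c * real n powr (-r)"
    and d: "0 \<le> d" "d < 1/2 - r"
    and K: "(\<lambda>n. real (K n)) \<in> O(\<lambda>n. real n powr d)"
  let ?sel = "\<lambda>n. {\<omega> \<in> space (sample_law n (D n)).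
                   S n \<subseteq> {(j, l) \<in> {1..p n} \<times> {1..p n}. emp_KIF_score n \<omega> (K n) j l > c * real n powr (-r)}}"
  show "(\<lambda>n. 1 - measure (sample_law n (D n)) (?sel n))
         \<in> O(\<lambda>n. real (card (S n)) * real n powr d
                  * exp (- (c^2 * real n powr (1 - 2 * (r + d))) / (72 * 3^2)))"
  proof (rule bigoI[where c=2])
    show "\<forall>\<^sub>F n in sequentially. norm (1 - measure (sample_law n (D n)) (?sel n))
        \<le> 2 * norm (real (card (S n)) * real n powr d
                  * exp (- (c^2 * real n powr (1 - 2 * (r + d))) / (72 * 3^2)))"
      using eventually_bias_le[OF \<open>c > 0\<close> d(2) K] eventually_ge_at_top[of 1]
    proof eventually_elim
      case (elim n)
      interpret obs_sample "D n" n
        using prob sets elim by (intro obs_sample.intro obs_sample_axioms.intro) auto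
      let ?e = "c * real n powr (-r)"
      \<comment> \<open>Selecting the relevant couples requires control of these couples alone: a
        deviation of at most \<open>c * n powr (-r)\<close> from a score above
        \<open>2 * c * n powr (-r)\<close> stays above the threshold. This is why
        \<open>card (S n)\<close> takes the place of the number of all couples.\<close>
      let ?G = "{\<omega> \<in> space sample. \<forall>(j, l)\<in>S n. \<bar>emp_KIF_score n \<omega> (K n) j l - KIF_score (D n) (K n) j l\<bar> \<le> ?e}"
      have pos: "class_prob (D n) k > 0" if "k \<in> {1..K n}" for k
        using C1 that pK \<open>c1 > 0\<close> by (meson divide_pos_pos less_le_trans of_nat_0_less_iff zero_less_one)
      have "finite (S n)"
        using S_sub by (meson finite_SigmaI finite_atLeastAtMost finite_subset)
      have "?G \<subseteq> ?sel n"
      proof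
        fix \<omega> assume \<omega>: "\<omega> \<in> ?G"
        have "emp_KIF_score n \<omega> (K n) j l > ?e" if "(j, l) \<in> S n" for j l
        proof -
          have "\<bar>emp_KIF_score n \<omega> (K n) j l - KIF_score (D n) (K n) j l\<bar> \<le> ?e"
            "KIF_score (D n) (K n) j l > 2 * c * real n powr (-r)"
            using \<omega> C2 that by auto
          then show ?thesis by linarith
        qed
        with \<omega> S_sub[rule_format, of n] show "\<omega> \<in> ?sel n"
          by (auto simp: sample_law_def)
      qed
      \<comment> \<open>Monotonicity of the measure needs the larger set to be an event, because
        \<open>measure\<close> is 0 by convention outside the sigma-algebra.\<close>
      moreover have "?sel n \<in> S.events"
      proof -
        have "?sel n = {\<omega> \<in> space sample. \<forall>q\<in>S n. emp_KIF_score n \<omega> (K n) (fst q) (snd q) > ?e}"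
          using S_sub[rule_format, of n] by (fastforce simp: sample_law_def)
        also have "\<dots> \<in> S.events"
          using \<open>finite (S n)\<close> emp_KIF_score_measurable[OF pos] by (intro sets.sets_Collect_finite_All) auto
        finally show ?thesis .
      qed
      ultimately have "S.prob ?G \<le> measure (sample_law n (D n)) (?sel n)"
        unfolding sample_law_def by (intro S.finite_measure_mono)
      moreover have "1 - S.prob ?G \<le> real (card (S n)) * (2 * exp (- (real n * ?e\<^sup>2) / 392))"
        using pK elim \<open>c > 0\<close> \<open>finite (S n)\<close> by (intro KIF_score_uniform_deviation(2) pos; simp)
      moreover have "real (card (S n)) * (2 * exp (- (real n * ?e\<^sup>2) / 392))
          \<le> real (card (S n)) * (2 * (real n powr d * exp (- (c\<^sup>2 * real n powr (1 - 2 * (r + d))) / (72 * 3\<^sup>2))))"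
        using elim d by (intro mult_left_mono tail_exponent_le) auto
      ultimately have "1 - measure (sample_law n (D n)) (?sel n)
          \<le> real (card (S n)) * (2 * (real n powr d * exp (- (c\<^sup>2 * real n powr (1 - 2 * (r + d))) / (72 * 3\<^sup>2))))"
        by linarith
      moreover have "measure (sample_law n (D n)) (?sel n) \<le> 1"
        unfolding sample_law_def by (rule S.P.prob_le_1)
      ultimately show ?case
        by (simp add: mult_ac)
    qed
  qed
qed

end
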